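(* For every integer $d\geq 5$ and every real $0 \leq r<1$, there is a simplicial $d$-polytope $P$ with $\rho(H(P)) \geq r$.
   Context: For a hypergraph $H=(V,\mathcal{E})$, a transversal is a subset of $V$ intersecting every hyperedge in $\mathcal{E}$; the transversal number $\tau(H)$ is the minimum size of a transversal, and the transversal ratio is $\rho(H)=\tau(H)/|V|$. For a $d$-polytope $P$ with vertex set $V$, $H(P)$ is the hypergraph on $V$ whose hyperedges are the vertex sets of the facets of $P$. *)

theory Defs
  imports "HOL-Analysis.Analysis"
begin

definition is_transversal :: "'v set \<Rightarrow> 'v set set \<Rightarrow> 'v set \<Rightarrow> bool" where
  "is_transversal V E T \<longleftrightarrow> T \<subseteq> V \<and> (\<forall>e\<in>E. T \<inter> e \<noteq> {})"

definition transversal_number :: "'v set \<Rightarrow> 'v set set \<Rightarrow> nat" where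
  "transversal_number V E = (LEAST k. \<exists>T. is_transversal V E T \<and> card T = k)"

definition transversal_ratio :: "'v set \<Rightarrow> 'v set set \<Rightarrow> real" where
  "transversal_ratio V E = real (transversal_number V E) / real (card V)"

definition poly_vertices :: "'a::euclidean_space set \<Rightarrow> 'a set" where
  "poly_vertices P = {v. v extreme_point_of P}"

definition facet_hyperedges :: "'a::euclidean_space set \<Rightarrow> 'a set set" where
  "facet_hyperedges P = {poly_vertices F | F. F facet_of P}"

definition simplicial_polytope :: "'a::euclidean_space set \<Rightarrow> bool" where
  "simplicial_polytope P \<longleftrightarrow> polytope P \<and> (\<forall>F. F facet_of P \<longrightarrow> (\<exists>n. n simplex F))"

end

theory Submission
  imports Defs
begin

text \<open>
  Place points with coordinates $(x, x^2, y, y^2, z_4, \dots, z_{d-1})$ in $\mathbb{R}^d$, so that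
  facets correspond to axis-parallel ellipses in the $(x,y)$-plane with $d$ points on the boundary
  and no other point inside. Give $x$ and $y$ nested expansions in a tiny scale, with the
  significance of the digits of $y$ reversed: at every level $i$ the $M^L$ points then split into
  groups of $M$ points which, after an affine rescaling of each axis, look like a fixed pattern
  while all other points are arbitrarily far away. Inside each group the pattern may be arranged
  freely so that any prescribed $d$ of its points form an empty ellipse. There are $L M^{L-1}$
  groups, so for $L$ large independent choices of these $d$-subsets beat the $2^{M^L}$ point sets in
  a union bound, and some choice leaves no set of density $1-r$ without a facet. A perturbation into
  general position makes the polytope simplicial and preserves the chosen facets. The complement of
  a transversal contains no facet, hence has density below $1-r$.
\<close>

section \<open>Polytopes in general position\<close>

text \<open>The bound d \<ge> 5 enters through the pattern circle. With the rational parameter t and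
  after multiplication by (1 + t^2)^2, the functions 1, x, x^2, y, y^2 span only the even
  polynomials of degree at most 4 together with t + t^3. The first extra coordinate supplies the
  missing t (t^4 would add nothing), the later ones t^5, ..., t^(d-1). So d + 1 functions span the
  d-dimensional space of polynomials of degree below d, with x^2 + y^2 = 1 as their only relation,
  and d points of the circle lie on just one hyperplane.

  The obstacle to independence is that selecting a d-subset rearranges its group, which decides
  which points enter which copy; groups inside the copies therefore depend on the choices above
  them. This is why the choices form a tree and are counted by recursion on its depth: whatever the
  root chooses, the copies partition a given set, and so do the groups, so one exponential weight in
  the size of the set serves both splittings. Geometrically, only x and the extra coordinates may
  depend on the choices, while y is common to all trees.\<close>

definition in_general_position :: "'a::euclidean_space set \<Rightarrow> bool" where
  "in_general_position V \<longleftrightarrow> (\<forall>C\<subseteq>V. card C \<le> DIM('a) + 1 \<longrightarrow> \<not> affine_dependent C)"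

lemma negligible_affine_hull_small:
  fixes C :: "'a::euclidean_space set"
  assumes "finite C" "card C \<le> DIM('a)"
  shows "negligible (affine hull C)"
proof -
  have "aff_dim (affine hull C) < int DIM('a)"
    using aff_dim_le_card[OF assms(1)] assms(2) by simp
  then show ?thesis
    by (metis aff_dim_nonempty_interior affine_affine_hull affine_imp_convex less_irrefl
        negligible_convex_interior)
qed

text \<open>Points are moved one at a time. A new point only has to avoid the affine hulls of at
  most \<open>DIM('a)\<close> earlier points, which are finitely many null sets and cannot cover a
  ball.\<close>

lemma general_position_perturbation:
  fixes P :: "'i \<Rightarrow> 'a::euclidean_space"
  assumes "finite I" "\<delta> > 0"
  shows "\<exists>P'. (\<forall>v\<in>I. dist (P' v) (P v) < \<delta>) \<and> inj_on P' I \<and> in_general_position (P' ` I)"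
  using assms(1)
proof (induction I rule: finite_induct)
  case empty
  then show ?case by (auto simp: in_general_position_def)
next
  case (insert v I)
  then obtain P' where P': "\<forall>v\<in>I. dist (P' v) (P v) < \<delta>" "inj_on P' I"
    "in_general_position (P' ` I)" by auto
  define \<C> where "\<C> = {C. C \<subseteq> P' ` I \<and> card C \<le> DIM('a)}"
  have fin: "finite (P' ` I)" using insert by auto
  have "finite \<C>" unfolding \<C>_def using fin by (auto intro: finite_subset[of _ "Pow (P' ` I)"])
  then have "negligible (\<Union>C\<in>\<C>. affine hull C)"
    by (intro negligible_Union)
      (auto simp: \<C>_def intro!: negligible_affine_hull_small finite_subset[OF _ fin])
  moreover have "\<not> negligible (ball (P v) \<delta>)"
    using open_not_negligible[of "ball (P v) \<delta>"] assms(2) by auto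
  ultimately obtain p where p: "p \<in> ball (P v) \<delta>" "p \<notin> (\<Union>C\<in>\<C>. affine hull C)"
    by (meson negligible_subset subsetI)
  define Q where "Q = P'(v := p)"
  have QI: "Q w = P' w" if "w \<in> I" for w using that insert.hyps by (auto simp: Q_def)
  have imQ: "Q ` I = P' ` I" using QI by auto
  \<comment> \<open>Singletons are among the avoided sets, so injectivity comes for free.\<close>
  have pn: "p \<notin> P' ` I"
  proof
    assume "p \<in> P' ` I"
    then have "{p} \<in> \<C>" by (auto simp: \<C>_def Suc_leI)
    moreover have "p \<in> affine hull {p}" by (simp add: hull_inc)
    ultimately show False using p(2) by blast
  qed
  have "in_general_position (Q ` insert v I)"
    unfolding in_general_position_def
  proof (intro allI impI)
    fix C assume C: "C \<subseteq> Q ` insert v I" "card C \<le> DIM('a) + 1"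
    show "\<not> affine_dependent C"
    proof (cases "p \<in> C")
      case False
      then have "C \<subseteq> P' ` I" using C(1) imQ by (auto simp: Q_def)
      then show ?thesis using P'(3) C(2) by (auto simp: in_general_position_def)
    next
      case True
      let ?C = "C - {p}"
      have sub: "?C \<subseteq> P' ` I" using C(1) imQ by (auto simp: Q_def)
      have "finite C" using C(1) insert.hyps by (meson finite.insertI finite_imageI finite_subset)
      then have c: "card ?C \<le> DIM('a)" using C(2) True by simp
      then have "?C \<in> \<C>" using sub by (auto simp: \<C>_def)
      then have "p \<notin> affine hull ?C" using p(2) by blast
      moreover have "\<not> affine_dependent ?C"
        using P'(3) sub c by (auto simp: in_general_position_def)
      ultimately have "\<not> affine_dependent (insert p ?C)" by (rule affine_independent_insert[rotated])
      then show ?thesis using True by (simp add: insert_absorb)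
    qed
  qed
  moreover have "inj_on Q (insert v I)"
    using P'(2) pn imQ QI insert.hyps
    by (auto simp: inj_on_insert Q_def cong: inj_on_cong)
  moreover have "\<forall>w\<in>insert v I. dist (Q w) (P w) < \<delta>"
    using P'(1) QI p(1) by (auto simp: Q_def dist_commute)
  ultimately show ?case by blast
qed

lemma general_position_aff_dim:
  fixes V :: "'a::euclidean_space set"
  assumes "in_general_position V" "finite V" "card V \<ge> DIM('a) + 1"
  shows "aff_dim V = DIM('a)"
proof -
  obtain C where C: "C \<subseteq> V" "card C = DIM('a) + 1"
    using assms(3) by (meson obtain_subset_with_card_n)
  then have "\<not> affine_dependent C" using assms(1) by (auto simp: in_general_position_def)
  then have "aff_dim C = DIM('a)" using aff_dim_affine_independent[of C] C by auto
  then show ?thesis using aff_dim_subset[OF C(1)] aff_dim_le_DIM[of V] by linarith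
qed

text \<open>More than \<open>DIM('a)\<close> points in general position span the whole space, so a
  facet is the hull of at most \<open>DIM('a)\<close> of them, and these are affinely
  independent.\<close>

lemma simplicial_polytope_general_position:
  fixes V :: "'a::euclidean_space set"
  assumes "in_general_position V" "finite V" "card V \<ge> DIM('a) + 1"
  shows "simplicial_polytope (convex hull V)"
  unfolding simplicial_polytope_def
proof (intro conjI allI impI)
  show "polytope (convex hull V)" using assms(2) by (auto simp: polytope_def)
next
  fix F assume F: "F facet_of (convex hull V)"
  then have F': "F face_of (convex hull V)" "aff_dim F = DIM('a) - 1"
    using general_position_aff_dim[OF assms] by (auto simp: facet_of_def aff_dim_convex_hull)
  obtain C where C: "C \<subseteq> V" "F = convex hull C"
    using face_of_convex_hull_subset[OF finite_imp_compact[OF assms(2)] F'(1)] by blast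
  have finC: "finite C" using C(1) assms(2) finite_subset by blast
  have "card C \<le> DIM('a)"
  proof (rule ccontr)
    assume "\<not> ?thesis"
    moreover have "in_general_position C" using assms(1) C(1) by (auto simp: in_general_position_def)
    ultimately have "aff_dim C = DIM('a)" using general_position_aff_dim[of C] finC by simp
    then show False using F'(2) C(2) by (simp add: aff_dim_convex_hull)
  qed
  then have "\<not> affine_dependent C" using assms(1) C(1) by (auto simp: in_general_position_def)
  then show "\<exists>n. n simplex F"
    unfolding simplex_def using C(2) by (intro exI[of _ "int (card C) - 1"]) auto
qed

text \<open>Strictness off \<open>C\<close> forces the exposed face to be the simplex on
  \<open>C\<close>; affine independence of \<open>C\<close> then gives both its dimension and its
  extreme points.\<close>

lemma supported_simplex_is_facet:
  fixes V :: "'a::euclidean_space set"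
  assumes gp: "in_general_position V" "finite V" "card V \<ge> DIM('a) + 1"
    and C: "C \<subseteq> V" "card C = DIM('a)"
    and sup: "\<And>p. p \<in> C \<Longrightarrow> a \<bullet> p = b" "\<And>p. p \<in> V - C \<Longrightarrow> a \<bullet> p > b"
  shows "C \<in> facet_hyperedges (convex hull V)"
proof -
  have ge: "a \<bullet> x \<ge> b" if "x \<in> convex hull V" for x
  proof -
    have "V \<subseteq> {x. a \<bullet> x \<ge> b}" using sup by (force intro: less_imp_le)
    then have "convex hull V \<subseteq> {x. a \<bullet> x \<ge> b}" by (simp add: convex_halfspace_ge hull_minimal)
    then show ?thesis using that by auto
  qed
  define F where "F = convex hull V \<inter> {x. a \<bullet> x = b}"
  have F: "F face_of convex hull V"
    unfolding F_def by (rule face_of_Int_supporting_hyperplane_ge) (use ge in auto)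
  obtain C' where C': "C' \<subseteq> V" "F = convex hull C'"
    using face_of_convex_hull_subset[OF finite_imp_compact[OF gp(2)] F] by blast
  have "C' \<subseteq> C"
  proof
    fix p assume p: "p \<in> C'"
    then have "p \<in> F" using C'(2) by (simp add: hull_inc)
    then show "p \<in> C" using sup(2)[of p] p C'(1) by (auto simp: F_def)
  qed
  moreover have "C \<subseteq> F" using C(1) sup(1) by (auto simp: F_def hull_inc)
  moreover have "convex F" using F face_of_imp_convex by blast
  ultimately have FC: "F = convex hull C"
    using C'(2) by (metis hull_minimal hull_mono subset_antisym)
  have ind: "\<not> affine_dependent C" using gp(1) C by (auto simp: in_general_position_def)
  have "aff_dim F = DIM('a) - 1"
    using aff_dim_affine_independent[OF ind] C(2) FC by (simp add: aff_dim_convex_hull)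
  moreover have "F \<noteq> {}" using FC C(2) by auto
  ultimately have "F facet_of convex hull V"
    using F general_position_aff_dim[OF gp] by (simp add: facet_of_def aff_dim_convex_hull)
  moreover have "poly_vertices F = C"
    unfolding poly_vertices_def FC using extreme_point_of_convex_hull_affine_independent[OF ind] by auto
  ultimately show ?thesis unfolding facet_hyperedges_def by blast
qed

section \<open>Transversals and facet-free sets\<close>

lemma vertices_transversal:
  fixes P :: "'a::euclidean_space set"
  assumes "polytope P"
  shows "is_transversal (poly_vertices P) (facet_hyperedges P) (poly_vertices P)"
  unfolding is_transversal_def
proof (intro conjI ballI)
  fix h assume "h \<in> facet_hyperedges P"
  then obtain F where F: "h = poly_vertices F" "F facet_of P" by (auto simp: facet_hyperedges_def)
  then have face: "F face_of P" "F \<noteq> {}" by (auto simp: facet_of_def)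
  have "compact F" "convex F"
    using face assms by (auto intro: face_of_imp_compact face_of_imp_convex
        polytope_imp_compact polytope_imp_convex)
  then obtain x where "x extreme_point_of F"
    using extreme_point_exists_convex face(2) by blast
  then show "poly_vertices P \<inter> h \<noteq> {}"
    using extreme_point_of_face[OF face(1)] F(1) by (auto simp: poly_vertices_def)
qed simp

text \<open>The complement in \<open>V\<close> of a least transversal contains no hyperedge and is
  therefore sparse. Points of \<open>V\<close> that are not vertices of the hull do no harm: the
  transversal is compared with all of \<open>V\<close>, while the ratio divides by the smaller
  number of vertices.\<close>

lemma transversal_ratio_lower_bound:
  fixes V :: "'a::euclidean_space set"
  assumes V: "finite V" "V \<noteq> {}"
    and dense: "\<And>S. S \<subseteq> V \<Longrightarrow> real (card S) \<ge> \<epsilon> * real (card V) \<Longrightarrow>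
      \<exists>C \<in> facet_hyperedges (convex hull V). C \<subseteq> S"
    and \<epsilon>: "\<epsilon> \<le> 1"
  shows "transversal_ratio (poly_vertices (convex hull V)) (facet_hyperedges (convex hull V)) \<ge> 1 - \<epsilon>"
proof -
  let ?P = "convex hull V"
  let ?W = "poly_vertices ?P" and ?E = "facet_hyperedges ?P"
  have poly: "polytope ?P" using V(1) by (auto simp: polytope_def)
  have WV: "?W \<subseteq> V" unfolding poly_vertices_def by (rule extreme_points_of_convex_hull)
  \<comment> \<open>\<open>LEAST\<close> is attained only if some transversal exists; the full
    vertex set is one.\<close>
  have "\<exists>k. \<exists>T. is_transversal ?W ?E T \<and> card T = k" using vertices_transversal[OF poly] by blast
  then have "\<exists>T. is_transversal ?W ?E T \<and> card T = transversal_number ?W ?E"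
    unfolding transversal_number_def by (rule LeastI_ex)
  then obtain T where T: "is_transversal ?W ?E T" "card T = transversal_number ?W ?E" by blast
  have TV: "T \<subseteq> V" using T(1) WV by (auto simp: is_transversal_def)
  have "\<not> real (card (V - T)) \<ge> \<epsilon> * real (card V)"
    using dense[of "V - T"] T(1) by (auto simp: is_transversal_def)
  moreover have "real (card (V - T)) = real (card V) - real (card T)"
    using TV V(1) by (simp add: card_Diff_subset card_mono finite_subset of_nat_diff)
  ultimately have 1: "real (card T) \<ge> (1 - \<epsilon>) * real (card V)" by (simp add: algebra_simps)
  have "card ?W \<le> card V" using WV V(1) card_mono by blast
  then have 2: "(1 - \<epsilon>) * real (card ?W) \<le> (1 - \<epsilon>) * real (card V)"
    using \<epsilon> by (intro mult_left_mono) auto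
  have "?W \<noteq> {}"
    using extreme_point_exists_convex[of ?P] V poly
    by (auto simp: poly_vertices_def polytope_imp_compact)
  then have "card ?W > 0" using WV V(1) by (meson card_gt_0_iff finite_subset)
  then show ?thesis
    unfolding transversal_ratio_def T(2)[symmetric] using 1 2 by (simp add: le_divide_eq)
qed

section \<open>A random hypergraph on words\<close>

definition words :: "nat \<Rightarrow> nat \<Rightarrow> nat list set" where
  "words M L = {w. set w \<subseteq> {..<M} \<and> length w = L}"

lemma finite_words [simp]: "finite (words M L)"
  by (simp add: words_def finite_lists_length_eq)

lemma card_words: "card (words M L) = M ^ L"
  by (simp add: words_def card_lists_length_eq)

lemma words_0 [simp]: "words M 0 = {[]}"
  by (auto simp: words_def)

lemma Cons_in_words [simp]: "m # v \<in> words M (Suc L) \<longleftrightarrow> m < M \<and> v \<in> words M L"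
  by (auto simp: words_def)

lemma words_SucE:
  assumes "w \<in> words M (Suc L)"
  obtains m v where "w = m # v" "m < M" "v \<in> words M L"
  using assms by (cases w) (auto simp: words_def)

text \<open>A bijection of $\{0,\dots,M-1\}$ that fixes \<open>D\<close> pointwise and strictly decreases every other
  positive number, so that a point off \<open>D\<close> leaves the pattern circle outwards.\<close>
definition rearrange :: "nat \<Rightarrow> nat set \<Rightarrow> nat \<Rightarrow> nat" where
  "rearrange M D j =
    (if j \<in> D then j else if j = 0 then Max ({..<M} - D) else Max ({..<j} - D))"

definition blocks :: "nat \<Rightarrow> nat \<Rightarrow> nat set set" where
  "blocks d M = {D. D \<subseteq> {1..<M} \<and> card D = d}"

lemma finite_blocks [simp]: "finite (blocks d M)"
  by (rule finite_subset[of _ "Pow {1..<M}"]) (auto simp: blocks_def)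

lemma card_blocks: "card (blocks d M) = (M - 1) choose d"
  using n_subsets[of "{1..<M}" d] by (simp add: blocks_def)

lemma rearrange_nonblock:
  assumes "D \<in> blocks d M" "j < M" "j \<notin> D"
  shows "rearrange M D j \<in> {..<M} - D" "j > 0 \<Longrightarrow> rearrange M D j < j"
proof -
  \<comment> \<open>Blocks avoid 0, which keeps the sets under \<open>Max\<close> nonempty.\<close>
  have 0: "0 \<notin> D" using assms(1) by (auto simp: blocks_def)
  have "0 \<in> {..<M} - D" using 0 assms(2) by auto
  then have "Max ({..<M} - D) \<in> {..<M} - D" by (intro Max_in) auto
  moreover have "Max ({..<j} - D) \<in> {..<j} - D" if "j > 0"
  proof -
    have "0 \<in> {..<j} - D" using 0 that by auto
    then show ?thesis by (intro Max_in) auto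
  qed
  ultimately show "rearrange M D j \<in> {..<M} - D" "j > 0 \<Longrightarrow> rearrange M D j < j"
    using assms by (auto simp: rearrange_def)
qed

text \<open>Off \<open>D\<close> the map is the cyclic shift of the complement: every element goes
  to its predecessor there, and 0, the smallest, goes to the largest.\<close>

lemma rearrange_bij:
  assumes "D \<in> blocks d M"
  shows "bij_betw (rearrange M D) {..<M} {..<M}"
proof -
  have lt: "rearrange M D i \<noteq> rearrange M D j" if "i < j" "j < M" "i \<notin> D" "j \<notin> D" for i j
  proof (cases "i = 0")
    case True
    have "rearrange M D j < j" using rearrange_nonblock(2)[OF assms] that by auto
    also have "j \<le> rearrange M D 0" using that True by (auto simp: rearrange_def)
    finally show ?thesis using True by simp
  next
    case False
    have "rearrange M D i < i" using rearrange_nonblock(2)[OF assms] that False by auto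
    also have "i \<le> rearrange M D j" using that by (auto simp: rearrange_def)
    finally show ?thesis by simp
  qed
  have "inj_on (rearrange M D) {..<M}"
  proof (rule inj_onI)
    fix i j assume ij: "i \<in> {..<M}" "j \<in> {..<M}" and eq: "rearrange M D i = rearrange M D j"
    have D: "k \<in> D \<Longrightarrow> rearrange M D k = k" for k by (simp add: rearrange_def)
    show "i = j"
    proof (cases "i \<in> D \<or> j \<in> D")
      case True
      then show ?thesis using eq D rearrange_nonblock(1)[OF assms] ij by (metis DiffE lessThan_iff)
    next
      case False
      then show ?thesis using lt[of i j] lt[of j i] eq ij by (metis lessThan_iff linorder_neqE_nat)
    qed
  qed
  moreover have "rearrange M D ` {..<M} \<subseteq> {..<M}"
    using rearrange_nonblock(1)[OF assms] by (force simp: rearrange_def)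
  ultimately show ?thesis
    by (simp add: bij_betw_def endo_inj_surj)
qed

text \<open>A tree of depth \<open>Suc L\<close> glues \<open>M\<close> copies \<open>ch j\<close> of structures on \<open>words M L\<close>. Words list the
  digits of the \<open>y\<close>-coordinate; the group of \<open>v\<close> consists of the words \<open>m # v\<close>, and \<open>m # v\<close>
  lies in copy \<open>j\<close> for \<open>m = rearrange M (D v) j\<close>.\<close>
datatype tree = Leaf | Node "nat list \<Rightarrow> nat set" "nat \<Rightarrow> tree"

text \<open>\<open>PiE\<close> fixes the values outside the relevant domain, so every system of
  choices is counted once and the cardinality is a product.\<close>

fun trees :: "nat \<Rightarrow> nat \<Rightarrow> nat \<Rightarrow> tree set" where
  "trees d M 0 = {Leaf}"
| "trees d M (Suc L) = (\<lambda>(D, ch). Node D ch) `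
    (PiE (words M L) (\<lambda>_. blocks d M) \<times> PiE {..<M} (\<lambda>_. trees d M L))"

definition shifted :: "nat \<Rightarrow> (nat list \<Rightarrow> nat set) \<Rightarrow> nat \<Rightarrow> nat list \<Rightarrow> nat list" where
  "shifted M D j v = rearrange M (D v) j # v"

fun edges :: "nat \<Rightarrow> nat \<Rightarrow> tree \<Rightarrow> nat list set set" where
  "edges M (Suc L) (Node D ch) =
    (\<lambda>v. (\<lambda>m. m # v) ` D v) ` words M L \<union> (\<Union>j<M. (`) (shifted M D j) ` edges M L (ch j))"
| "edges _ _ _ = {}"

definition independent_trees :: "nat \<Rightarrow> nat \<Rightarrow> nat \<Rightarrow> nat list set \<Rightarrow> tree set" where
  "independent_trees d M L S = {T \<in> trees d M L. \<forall>e\<in>edges M L T. \<not> e \<subseteq> S}"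

lemma finite_trees [simp]: "finite (trees d M L)"
  by (induction L) (auto intro!: finite_imageI finite_cartesian_product finite_PiE)

lemma card_trees_Suc:
  "card (trees d M (Suc L)) = card (blocks d M) ^ (M ^ L) * card (trees d M L) ^ M"
proof -
  have "inj_on (\<lambda>(D, ch). Node D ch) X" for X by (auto simp: inj_on_def)
  then show ?thesis
    by (simp add: card_image card_cartesian_product card_PiE card_words)
qed

lemma shifted_in_words:
  assumes "v \<in> words M L" "j < M" "D v \<in> blocks d M"
  shows "shifted M D j v \<in> words M (Suc L)"
  using assms rearrange_bij[OF assms(3)] by (auto simp: shifted_def bij_betw_def)

lemma shifted_bij:
  assumes "\<And>v. v \<in> words M L \<Longrightarrow> D v \<in> blocks d M"
  shows "bij_betw (\<lambda>(j, v). shifted M D j v) ({..<M} \<times> words M L) (words M (Suc L))"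
proof -
  have "inj_on (\<lambda>(j, v). shifted M D j v) ({..<M} \<times> words M L)"
    using rearrange_bij[OF assms]
    by (auto simp: inj_on_def shifted_def bij_betw_def)
  moreover have "(\<lambda>(j, v). shifted M D j v) ` ({..<M} \<times> words M L) \<subseteq> words M (Suc L)"
    using shifted_in_words[OF _ _ assms] by auto
  moreover have "card ({..<M} \<times> words M L) = card (words M (Suc L))"
    by (simp add: card_words card_cartesian_product)
  ultimately show ?thesis
    unfolding bij_betw_def by (metis card_image card_subset_eq finite_words)
qed

lemma edges_props:
  assumes "T \<in> trees d M L" "e \<in> edges M L T"
  shows "e \<subseteq> words M L \<and> card e = d"
  using assms
proof (induction L arbitrary: T e)
  case (Suc L)
  then obtain D ch where T: "T = Node D ch" and D: "\<And>v. v \<in> words M L \<Longrightarrow> D v \<in> blocks d M"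
    and ch: "\<And>j. j < M \<Longrightarrow> ch j \<in> trees d M L" by (auto simp: PiE_iff)
  consider v where "v \<in> words M L" "e = (\<lambda>m. m # v) ` D v"
    | j e' where "j < M" "e' \<in> edges M L (ch j)" "e = shifted M D j ` e'"
    using Suc.prems(2) T by auto
  then show ?case
  proof cases
    case 1
    then show ?thesis using D[OF 1(1)]
      by (auto simp: blocks_def card_image inj_on_def)
  next
    case 2
    then have "e' \<subseteq> words M L \<and> card e' = d" using Suc.IH ch by blast
    moreover have "inj_on (shifted M D j) e'" by (auto simp: inj_on_def shifted_def)
    ultimately show ?thesis using 2(1,3) shifted_in_words[OF _ 2(1) D] by (auto simp: card_image)
  qed
qed simp

section \<open>Counting the trees that leave a given set free of edges\<close>

fun weight_exponent :: "nat \<Rightarrow> nat \<Rightarrow> nat \<Rightarrow> nat" where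
  "weight_exponent d M 0 = 0"
| "weight_exponent d M (Suc L) = M * weight_exponent d M L + d * M ^ L"

text \<open>The exponent is d for each of the L * M^(L-1) groups; the factor \<open>M\<close> on the
  left avoids the predecessor of \<open>L\<close>.\<close>

lemma weight_exponent_eq: "M * weight_exponent d M L = L * d * M ^ L"
  by (induction L) (auto simp: algebra_simps)

text \<open>The factor \<open>\<Lambda> ^ card R\<close> stands in for the probability bound $\Lambda^{-|R|}$: with this
  exponential weight the estimates of all groups and levels multiply up to $|S|$.\<close>
lemma card_blocks_not_subset:
  fixes \<Lambda> :: real
  assumes \<Lambda>: "\<Lambda> \<ge> 1" "real (card (blocks d M) - 1) * \<Lambda> ^ M \<le> real (card (blocks d M))"
    and R: "R \<subseteq> {..<M}"
  shows "real (card {D \<in> blocks d M. \<not> D \<subseteq> R}) * \<Lambda> ^ card R \<le> real (card (blocks d M)) * \<Lambda> ^ d"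
proof (cases "card R \<le> d")
  case True
  have "card {D \<in> blocks d M. \<not> D \<subseteq> R} \<le> card (blocks d M)" by (intro card_mono) auto
  then show ?thesis using True \<Lambda>(1) by (intro mult_mono power_increasing) auto
next
  case False
  have finR: "finite R" using R finite_subset by blast
  \<comment> \<open>A block inside \<open>R\<close> cannot use 0, so one more than d elements is
    required.\<close>
  have "card (R - {0}) \<ge> d" using False card_Diff1_le[of R 0] by (auto simp: card_Diff_singleton_if)
  then obtain D where D: "D \<subseteq> R - {0}" "card D = d" by (meson obtain_subset_with_card_n)
  then have "D \<in> blocks d M" using R by (force simp: blocks_def)
  then have "{D \<in> blocks d M. \<not> D \<subseteq> R} \<subset> blocks d M" using D by auto
  then have "card {D \<in> blocks d M. \<not> D \<subseteq> R} < card (blocks d M)" by (intro psubset_card_mono) auto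
  then have 1: "card {D \<in> blocks d M. \<not> D \<subseteq> R} \<le> card (blocks d M) - 1" by simp
  have "card R \<le> M" using R card_mono[of "{..<M}" R] by simp
  then have "real (card {D \<in> blocks d M. \<not> D \<subseteq> R}) * \<Lambda> ^ card R
      \<le> real (card (blocks d M) - 1) * \<Lambda> ^ M"
    using 1 \<Lambda>(1) by (intro mult_mono power_increasing) auto
  also have "\<dots> \<le> real (card (blocks d M))" by (rule \<Lambda>(2))
  also have "\<dots> \<le> real (card (blocks d M)) * \<Lambda> ^ d" using \<Lambda>(1) by (simp add: mult_le_cancel_left1)
  finally show ?thesis .
qed

text \<open>Once the root choice \<open>D\<close> is fixed, the conditions decouple into one per
  group and one per copy. The set that a child has to avoid depends on \<open>D\<close>, hence
  \<open>SIGMA\<close> in place of a plain product.\<close>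

lemma independent_trees_Suc:
  "independent_trees d M (Suc L) S = (\<lambda>(D, ch). Node D ch) `
    (SIGMA D:{D \<in> PiE (words M L) (\<lambda>_. blocks d M). \<forall>v\<in>words M L. \<not> D v \<subseteq> {m. m # v \<in> S}}.
      PiE {..<M} (\<lambda>j. independent_trees d M L {v \<in> words M L. shifted M D j v \<in> S}))"
  (is "?A = ?f ` ?B")
proof -
  have img: "shifted M D j ` e \<subseteq> S \<longleftrightarrow> e \<subseteq> {v \<in> words M L. shifted M D j v \<in> S}"
    if "ch \<in> PiE {..<M} (\<lambda>_. trees d M L)" "j < M" "e \<in> edges M L (ch j)" for D ch j e
    using edges_props[of "ch j" d M L e] that by (auto simp: PiE_iff)
  have node_iff: "Node D ch \<in> ?A \<longleftrightarrow> (D, ch) \<in> ?B" for D ch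
  proof (cases "D \<in> PiE (words M L) (\<lambda>_. blocks d M) \<and> ch \<in> PiE {..<M} (\<lambda>_. trees d M L)")
    case True
    have "(\<forall>e\<in>edges M (Suc L) (Node D ch). \<not> e \<subseteq> S) \<longleftrightarrow>
       (\<forall>v\<in>words M L. \<not> (\<lambda>m. m # v) ` D v \<subseteq> S) \<and>
       (\<forall>j<M. \<forall>e\<in>edges M L (ch j). \<not> shifted M D j ` e \<subseteq> S)"
      by (simp only: edges.simps ball_Un ball_UN ball_simps(9) Ball_image_comp o_def lessThan_iff) blast
    also have "\<dots> \<longleftrightarrow> (\<forall>v\<in>words M L. \<not> D v \<subseteq> {m. m # v \<in> S}) \<and>
       (\<forall>j<M. \<forall>e\<in>edges M L (ch j). \<not> e \<subseteq> {v \<in> words M L. shifted M D j v \<in> S})"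
      using img[OF conjunct2[OF True], of _ _ D] by (simp add: image_subset_iff subset_eq[of "D _"])
    finally have *: "(\<forall>e\<in>edges M (Suc L) (Node D ch). \<not> e \<subseteq> S) \<longleftrightarrow> \<dots>" .
    have "Node D ch \<in> trees d M (Suc L)" using True by auto
    then have "Node D ch \<in> ?A \<longleftrightarrow> (\<forall>e\<in>edges M (Suc L) (Node D ch). \<not> e \<subseteq> S)"
      unfolding independent_trees_def by blast
    then show ?thesis
      unfolding * using True by (simp add: independent_trees_def PiE_iff) blast
  next
    case False
    then show ?thesis by (auto simp: independent_trees_def PiE_iff)
  qed
  show ?thesis
  proof (rule set_eqI)
    fix T show "T \<in> ?A \<longleftrightarrow> T \<in> ?f ` ?B"
    proof (cases T)
      case Leaf
      then show ?thesis by (auto simp: independent_trees_def)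
    next
      case (Node D ch)
      have image: "Node D ch \<in> ?f ` X \<longleftrightarrow> (D, ch) \<in> X" for X by force
      show ?thesis unfolding Node image by (rule node_iff)
    qed
  qed
qed

text \<open>After division by the number of trees: a random tree has no edge inside \<open>S\<close>
  with probability at most \<Lambda> to the power d * (number of groups) - L * |S|. The factor L
  appears because a word lies in one group at each of the L levels.\<close>

lemma independent_trees_bound:
  fixes \<Lambda> :: real
  assumes \<Lambda>: "\<Lambda> \<ge> 1" "real (card (blocks d M) - 1) * \<Lambda> ^ M \<le> real (card (blocks d M))"
    and S: "S \<subseteq> words M L"
  shows "real (card (independent_trees d M L S)) * \<Lambda> ^ (L * card S)
    \<le> real (card (trees d M L)) * \<Lambda> ^ weight_exponent d M L"
  using S
proof (induction L arbitrary: S)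
  case 0
  have "card (independent_trees d M 0 S) \<le> card (trees d M 0)"
    by (intro card_mono) (auto simp: independent_trees_def)
  then show ?case by simp
next
  case (Suc L)
  define R where "R v = {m. m # v \<in> S}" for v
  define S' where "S' D j = {v \<in> words M L. shifted M D j v \<in> S}" for D j
  define \<D> where "\<D> = {D \<in> PiE (words M L) (\<lambda>_. blocks d M). \<forall>v\<in>words M L. \<not> D v \<subseteq> R v}"
  let ?B = "\<lambda>L S. real (card (independent_trees d M L S))"
  let ?N = "real (card (trees d M L))"
  let ?C = "real (card (blocks d M))"
  have finI: "finite (independent_trees d M L S)" for S L by (simp add: independent_trees_def)
  have fin\<D>: "finite \<D>" unfolding \<D>_def by (intro finite_subset[OF _ finite_PiE[of "words M L" "\<lambda>_. blocks d M"]]) auto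
  have finS: "finite S" using Suc.prems finite_subset finite_words by blast
  \<comment> \<open>Two partitions of \<open>S\<close> are used. The one into copies distributes the
    weight \<open>\<Lambda> ^ (L * card S)\<close> over the children; the one into groups,
    \<open>cardS2\<close>, absorbs the remaining factor \<open>\<Lambda> ^ card S\<close> at the
    root.\<close>
  have cardS: "card S = (\<Sum>j<M. card (S' D j))" if "D \<in> \<D>" for D
  proof -
    have b: "bij_betw (\<lambda>(j, v). shifted M D j v) ({..<M} \<times> words M L) (words M (Suc L))"
      using that by (intro shifted_bij[of _ _ _ d]) (auto simp: \<D>_def)
    have "S = (\<lambda>(j, v). shifted M D j v) ` (SIGMA j:{..<M}. S' D j)"
    proof (rule equalityI; rule subsetI)
      fix w assume w: "w \<in> S"
      then have "w \<in> (\<lambda>(j, v). shifted M D j v) ` ({..<M} \<times> words M L)"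
        using bij_betw_imp_surj_on[OF b] Suc.prems by blast
      then show "w \<in> (\<lambda>(j, v). shifted M D j v) ` (SIGMA j:{..<M}. S' D j)"
        using w by (force simp: S'_def)
    qed (auto simp: S'_def)
    moreover have "inj_on (\<lambda>(j, v). shifted M D j v) (SIGMA j:{..<M}. S' D j)"
      by (rule inj_on_subset[OF bij_betw_imp_inj_on[OF b]]) (auto simp: S'_def)
    ultimately have "card S = card (SIGMA j:{..<M}. S' D j)" by (metis card_image)
    then show ?thesis by (simp add: S'_def)
  qed
  have cardS2: "card S = (\<Sum>v\<in>words M L. card (R v))"
  proof -
    have "S = (\<lambda>(v, m). m # v) ` (SIGMA v:words M L. R v)"
    proof (rule equalityI; rule subsetI)
      fix w assume w: "w \<in> S"
      then obtain m v where "w = m # v" "v \<in> words M L" using Suc.prems words_SucE by blast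
      then show "w \<in> (\<lambda>(v, m). m # v) ` (SIGMA v:words M L. R v)"
        using w by (force simp: R_def)
    qed (auto simp: R_def)
    moreover have "inj_on (\<lambda>(v, m). m # v) (SIGMA v:words M L. R v)" by (auto simp: inj_on_def)
    ultimately have "card S = card (SIGMA v:words M L. R v)" by (metis card_image)
    moreover have "finite (R v)" for v
      using finite_vimageI[OF finS, of "\<lambda>m. m # v"] by (simp add: R_def vimage_def inj_on_def)
    ultimately show ?thesis by simp
  qed
  have RM: "R v \<subseteq> {..<M}" for v using Suc.prems by (auto simp: R_def)
  have "?B (Suc L) S = (\<Sum>D\<in>\<D>. \<Prod>j<M. ?B L (S' D j))"
  proof -
    have "inj_on (\<lambda>(D, ch). Node D ch) X" for X by (auto simp: inj_on_def)
    then have "card (independent_trees d M (Suc L) S) =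
        card (SIGMA D:\<D>. PiE {..<M} (\<lambda>j. independent_trees d M L (S' D j)))"
      unfolding independent_trees_Suc by (subst card_image) (simp_all add: \<D>_def R_def S'_def)
    then show ?thesis using fin\<D> finI by (simp add: card_SigmaI finite_PiE card_PiE)
  qed
  then have "?B (Suc L) S * \<Lambda> ^ (Suc L * card S) =
      (\<Sum>D\<in>\<D>. (\<Prod>j<M. ?B L (S' D j)) * \<Lambda> ^ (L * card S)) * \<Lambda> ^ card S"
    by (simp add: sum_distrib_right power_add mult.assoc mult.commute[of "\<Lambda> ^ card S"])
  also have "(\<Sum>D\<in>\<D>. (\<Prod>j<M. ?B L (S' D j)) * \<Lambda> ^ (L * card S)) =
      (\<Sum>D\<in>\<D>. \<Prod>j<M. ?B L (S' D j) * \<Lambda> ^ (L * card (S' D j)))"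
    by (intro sum.cong refl) (simp add: prod.distrib power_sum[symmetric] cardS sum_distrib_left)
  also have "\<dots> \<le> (\<Sum>D\<in>\<D>. \<Prod>j<M. ?N * \<Lambda> ^ weight_exponent d M L)"
    using \<Lambda>(1) by (intro sum_mono prod_mono conjI Suc.IH mult_nonneg_nonneg) (auto simp: S'_def)
  also have "\<dots> = real (card \<D>) * ((?N * \<Lambda> ^ weight_exponent d M L) ^ M)" by simp
  finally have 1: "?B (Suc L) S * \<Lambda> ^ (Suc L * card S)
      \<le> (real (card \<D>) * \<Lambda> ^ card S) * (?N * \<Lambda> ^ weight_exponent d M L) ^ M"
    using \<Lambda>(1) by (simp add: mult_right_mono algebra_simps)
  have "\<D> = PiE (words M L) (\<lambda>v. {D \<in> blocks d M. \<not> D \<subseteq> R v})"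
    unfolding \<D>_def by (rule set_eqI) (simp add: PiE_iff, blast)
  then have "real (card \<D>) * \<Lambda> ^ card S =
      (\<Prod>v\<in>words M L. real (card {D \<in> blocks d M. \<not> D \<subseteq> R v}) * \<Lambda> ^ card (R v))"
    by (simp add: card_PiE cardS2 power_sum prod.distrib)
  also have "\<dots> \<le> (\<Prod>v\<in>words M L. ?C * \<Lambda> ^ d)"
    using \<Lambda> RM by (intro prod_mono conjI card_blocks_not_subset mult_nonneg_nonneg) auto
  also have "\<dots> = (?C * \<Lambda> ^ d) ^ (M ^ L)" by (simp add: card_words)
  finally have 2: "real (card \<D>) * \<Lambda> ^ card S \<le> (?C * \<Lambda> ^ d) ^ (M ^ L)" .
  have "?B (Suc L) S * \<Lambda> ^ (Suc L * card S)
      \<le> (?C * \<Lambda> ^ d) ^ (M ^ L) * (?N * \<Lambda> ^ weight_exponent d M L) ^ M"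
    using 1 mult_right_mono[OF 2, of "(?N * \<Lambda> ^ weight_exponent d M L) ^ M"] \<Lambda>(1) by simp
  also have "\<dots> = real (card (trees d M (Suc L))) * \<Lambda> ^ weight_exponent d M (Suc L)"
    by (simp add: card_trees_Suc power_mult_distrib power_add power_mult[symmetric] algebra_simps
        del: trees.simps)
  finally show ?case .
qed

text \<open>The order of choices matters: \<open>M\<close> depends on d and \<epsilon>, then
  \<Lambda> on \<open>M\<close>, and only then is \<open>L\<close> taken large enough for the
  failure probability of one set to drop below 2^(-n), where n = M^L is the number of words.\<close>

proposition dense_sets_contain_edges:
  fixes \<epsilon> :: real
  assumes "\<epsilon> > 0"
  shows "\<exists>M L T. M > d \<and> L > 0 \<and> T \<in> trees d M L \<and>
    (\<forall>S\<subseteq>words M L. real (card S) \<ge> \<epsilon> * real (M ^ L) \<longrightarrow> (\<exists>e\<in>edges M L T. e \<subseteq> S))"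
proof -
  obtain M :: nat where M: "real M > 2 * real d / \<epsilon>" "M > d + 1"
    using reals_Archimedean2[of "max (2 * real d / \<epsilon>) (real (d + 1))"] by (auto simp: max_less_iff_conj)
  \<comment> \<open>This makes the loss in the exponent, L * d * n / M, at most half of the gain
    \<epsilon> * L * n from a dense set.\<close>
  then have dM: "2 * real d \<le> \<epsilon> * real M" using assms by (simp add: divide_less_eq mult.commute)
  define C where "C = card (blocks d M)"
  have C: "C \<ge> 1" using M(2) by (simp add: C_def card_blocks Suc_leI)
  obtain \<Lambda> :: real where \<Lambda>: "\<Lambda> > 1" "real (C - 1) * \<Lambda> ^ M \<le> real C"
  proof -
    \<comment> \<open>The largest base allowed by the second condition, which it turns into an
      equality. For \<open>C = 1\<close> the condition is trivial and any base above 1 will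
      do.\<close>
    define \<Lambda> where "\<Lambda> = root M (real C / real (C - 1))"
    show ?thesis
    proof (cases "C = 1")
      case True
      then show ?thesis by (intro that[of 2]) auto
    next
      case False
      then have "real C / real (C - 1) > 1" using C by (simp add: less_divide_eq)
      moreover have "M > 0" using M by simp
      ultimately have "\<Lambda> > 1" "\<Lambda> ^ M = real C / real (C - 1)"
        by (auto simp: \<Lambda>_def)
      then show ?thesis using False C by (intro that[of \<Lambda>]) auto
    qed
  qed
  have "\<Lambda> powr (\<epsilon> / 2) > 1" using \<Lambda>(1) assms by simp
  then obtain L0 where "(\<Lambda> powr (\<epsilon> / 2)) ^ L0 > 2" using real_arch_pow by blast
  moreover define L where "L = Suc L0"
  moreover have "(\<Lambda> powr (\<epsilon> / 2)) ^ L0 < (\<Lambda> powr (\<epsilon> / 2)) ^ Suc L0"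
    using \<open>\<Lambda> powr (\<epsilon> / 2) > 1\<close> by (intro power_strict_increasing) auto
  ultimately have L: "L > 0" "(\<Lambda> powr (\<epsilon> / 2)) ^ L > 2"
    unfolding L_def by (blast, linarith)
  define n where "n = M ^ L"
  define \<S> where "\<S> = {S. S \<subseteq> words M L \<and> real (card S) \<ge> \<epsilon> * real n}"
  have fin\<S>: "finite \<S>" by (rule finite_subset[of _ "Pow (words M L)"]) (auto simp: \<S>_def)
  have n: "n > 0" using M by (simp add: n_def)
  let ?N = "real (card (trees d M L))"
  have N: "?N > 0"
  proof -
    have "card (trees d M L) > 0" for L
      using C by (induction L) (simp_all add: card_trees_Suc C_def[symmetric] del: trees.simps(2))
    then show ?thesis by simp
  qed
  have bad: "real (card (independent_trees d M L S)) * 2 ^ n < ?N" if "S \<in> \<S>" for S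
  proof -
    let ?B = "real (card (independent_trees d M L S))"
    have S: "S \<subseteq> words M L" "real (card S) \<ge> \<epsilon> * real n" using that by (auto simp: \<S>_def)
    have le: "?B * \<Lambda> ^ (L * card S) \<le> ?N * \<Lambda> ^ weight_exponent d M L"
      using independent_trees_bound[OF _ _ S(1)] \<Lambda> by (simp add: C_def)
    have "real M * real (weight_exponent d M L) = real L * real n * real d"
      unfolding of_nat_mult[symmetric] weight_exponent_eq n_def by simp
    also have "2 * \<dots> \<le> real L * real n * (\<epsilon> * real M)"
      using mult_left_mono[OF dM, of "real L * real n"] by (simp add: algebra_simps)
    finally have "real M * (2 * real (weight_exponent d M L)) \<le> real M * (\<epsilon> * real L * real n)"
      by (simp add: algebra_simps)
    then have w: "real (weight_exponent d M L) \<le> (\<epsilon> / 2) * real L * real n"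
      using M(2) by (simp add: mult_le_cancel_left)
    have "\<epsilon> * real L * real n \<le> real (L * card S)"
      using mult_left_mono[OF S(2), of "real L"] by (simp add: algebra_simps)
    with w have "(\<epsilon> / 2) * real L * real n + real (weight_exponent d M L) \<le> real (L * card S)"
      by simp
    then have "\<Lambda> powr ((\<epsilon> / 2) * real L * real n + real (weight_exponent d M L)) \<le> \<Lambda> powr real (L * card S)"
      using \<Lambda>(1) by simp
    moreover have "\<Lambda> powr ((\<epsilon> / 2) * real L * real n) = ((\<Lambda> powr (\<epsilon> / 2)) ^ L) ^ n"
      using \<Lambda>(1) by (simp add: powr_powr powr_realpow[symmetric])
    ultimately have ge: "((\<Lambda> powr (\<epsilon> / 2)) ^ L) ^ n * \<Lambda> ^ weight_exponent d M L \<le> \<Lambda> ^ (L * card S)"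
      using \<Lambda>(1) by (simp add: powr_add powr_realpow del: of_nat_mult)
    have "?B * ((\<Lambda> powr (\<epsilon> / 2)) ^ L) ^ n * \<Lambda> ^ weight_exponent d M L \<le> ?N * \<Lambda> ^ weight_exponent d M L"
      using mult_left_mono[OF ge, of ?B] le by (simp add: algebra_simps)
    \<comment> \<open>The share of bad trees is at most q^(-n) with q > 2, against at most 2^n sets
      in the union bound.\<close>
    then have B: "?B * ((\<Lambda> powr (\<epsilon> / 2)) ^ L) ^ n \<le> ?N"
      using \<Lambda>(1) by (simp add: mult_le_cancel_right)
    show ?thesis
    proof (cases "?B = 0")
      case False
      have "2 ^ n < ((\<Lambda> powr (\<epsilon> / 2)) ^ L) ^ n" using L(2) n by (intro power_strict_mono) auto
      then have "?B * 2 ^ n < ?B * ((\<Lambda> powr (\<epsilon> / 2)) ^ L) ^ n"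
        using False by (simp add: mult_less_cancel_left_pos)
      then show ?thesis using B by simp
    qed (use N in simp)
  qed
  have "\<exists>T\<in>trees d M L. \<forall>S\<in>\<S>. T \<notin> independent_trees d M L S"
  proof (rule ccontr)
    assume neg: "\<not> ?thesis"
    then have "trees d M L \<subseteq> (\<Union>S\<in>\<S>. independent_trees d M L S)" by blast
    then have "card (trees d M L) \<le> card (\<Union>S\<in>\<S>. independent_trees d M L S)"
      using fin\<S> by (intro card_mono) (auto simp: independent_trees_def)
    also have "\<dots> \<le> (\<Sum>S\<in>\<S>. card (independent_trees d M L S))" by (rule card_UN_le[OF fin\<S>])
    finally have "?N \<le> (\<Sum>S\<in>\<S>. real (card (independent_trees d M L S)))"
      by (metis (mono_tags) of_nat_le_iff of_nat_sum)
    then have "?N * 2 ^ n \<le> (\<Sum>S\<in>\<S>. real (card (independent_trees d M L S)) * 2 ^ n)"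
      by (simp add: sum_distrib_right[symmetric])
    moreover have "\<S> \<noteq> {}" using neg N by (auto simp: card_gt_0_iff)
    ultimately have "?N * 2 ^ n < (\<Sum>S\<in>\<S>. ?N)"
      using sum_strict_mono[OF fin\<S> _ bad] by fastforce
    also have "\<dots> = real (card \<S>) * ?N" by simp
    also have "\<dots> \<le> 2 ^ n * ?N"
    proof (rule mult_right_mono)
      have "card \<S> \<le> 2 ^ n"
        using card_mono[of "Pow (words M L)" \<S>] by (auto simp: \<S>_def card_Pow card_words n_def)
      then have "real (card \<S>) \<le> real (2 ^ n)" by (rule of_nat_mono)
      then show "real (card \<S>) \<le> 2 ^ n" by simp
    qed simp
    finally show False by simp
  qed
  then obtain T where T: "T \<in> trees d M L" "\<forall>S\<in>\<S>. T \<notin> independent_trees d M L S" by blast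
  then show ?thesis
    using M(2) L(1) by (intro exI[of _ M] exI[of _ L] exI[of _ T]) (auto simp: \<S>_def n_def independent_trees_def)
qed

section \<open>The pattern and its lift\<close>

text \<open>Positive indices lie on the unit circle via $t \mapsto (2t, 1-t^2)/(1+t^2)$; index $0$ lies outside
  in either coordinate. Only the components $0$ and $\geq 4$ are used by the lift. After multiplication
  by $(1+t^2)^2$ the coordinate functions become polynomials of degree less than $d$, which makes
  the circle the only solution through $d$ of the points.\<close>
definition pattern_x :: "nat \<Rightarrow> nat \<Rightarrow> nat \<Rightarrow> real" where
  "pattern_x M j i =
    (let t = real j / real M in
     if j = 0 then (if i = 0 then 2 else 0)
     else if i = 0 then 2 * t / (1 + t\<^sup>2)
     else if i = 4 then t / (1 + t\<^sup>2)\<^sup>2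
     else t ^ i / (1 + t\<^sup>2)\<^sup>2)"

definition pattern_y :: "nat \<Rightarrow> nat \<Rightarrow> real" where
  "pattern_y M j = (let t = real j / real M in if j = 0 then 2 else (1 - t\<^sup>2) / (1 + t\<^sup>2))"

lemma circle_strict_mono:
  fixes t u :: real
  assumes "0 < t" "t < u" "u < 1"
  shows "2 * t / (1 + t\<^sup>2) < 2 * u / (1 + u\<^sup>2)" "(1 - u\<^sup>2) / (1 + u\<^sup>2) < (1 - t\<^sup>2) / (1 + t\<^sup>2)"
proof -
  have q: "1 + t\<^sup>2 > 0" "1 + u\<^sup>2 > 0" by (auto intro: add_pos_nonneg)
  have "t * u < 1 * 1" using assms by (intro mult_strict_mono) auto
  then have "(u - t) * (1 - t * u) > 0" using assms by simp
  then show "2 * t / (1 + t\<^sup>2) < 2 * u / (1 + u\<^sup>2)"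
    using q by (simp add: divide_less_eq less_divide_eq algebra_simps power2_eq_square)
  have "t\<^sup>2 < u\<^sup>2" using assms by (intro power_strict_mono) auto
  then show "(1 - u\<^sup>2) / (1 + u\<^sup>2) < (1 - t\<^sup>2) / (1 + t\<^sup>2)"
  proof -
    have "(1 - x) / (1 + x) = 2 / (1 + x) - 1" if "1 + x > 0" for x :: real
      using that by (simp add: field_simps)
    moreover have "2 / (1 + u\<^sup>2) < 2 / (1 + t\<^sup>2)"
      using \<open>t\<^sup>2 < u\<^sup>2\<close> q by (intro divide_strict_left_mono) auto
    ultimately show ?thesis using q by simp
  qed
qed

lemma circle_eq: "(2 * t / (1 + t\<^sup>2))\<^sup>2 + ((1 - t\<^sup>2) / (1 + t\<^sup>2))\<^sup>2 = (1::real)"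
proof -
  have q: "(1 + t\<^sup>2)\<^sup>2 \<noteq> 0" by (simp add: add_nonneg_eq_0_iff)
  have "(2 * t / (1 + t\<^sup>2))\<^sup>2 + ((1 - t\<^sup>2) / (1 + t\<^sup>2))\<^sup>2 = ((2 * t)\<^sup>2 + (1 - t\<^sup>2)\<^sup>2) / (1 + t\<^sup>2)\<^sup>2"
    by (simp add: power_divide add_divide_distrib)
  also have "(2 * t)\<^sup>2 + (1 - t\<^sup>2)\<^sup>2 = (1 + t\<^sup>2)\<^sup>2" by (simp add: power2_eq_square algebra_simps)
  finally show ?thesis using q by simp
qed

lemma pattern_props:
  assumes "j < M"
  shows "0 < j \<Longrightarrow> (pattern_x M j 0)\<^sup>2 + (pattern_y M j)\<^sup>2 = 1"
    and "0 < j \<Longrightarrow> 0 < pattern_y M j \<and> pattern_y M j < 1"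
    and "0 < j \<Longrightarrow> 0 < pattern_x M j 0 \<and> pattern_x M j 0 < 1"
    and "0 < i \<Longrightarrow> i < j \<Longrightarrow> pattern_x M i 0 < pattern_x M j 0"
    and "i < j \<Longrightarrow> pattern_y M j < pattern_y M i"
proof -
  define t where "t k = real k / real M" for k
  have t: "0 < t k" "t k < 1" "t k < t j \<longleftrightarrow> k < j" if "0 < k" "k < M" for k
    using that assms by (auto simp: t_def divide_strict_right_mono divide_less_cancel)
  have x: "pattern_x M k 0 = 2 * t k / (1 + (t k)\<^sup>2)" and y: "pattern_y M k = (1 - (t k)\<^sup>2) / (1 + (t k)\<^sup>2)"
    if "0 < k" for k
    using that by (simp_all add: pattern_x_def pattern_y_def t_def Let_def)
  show "0 < j \<Longrightarrow> (pattern_x M j 0)\<^sup>2 + (pattern_y M j)\<^sup>2 = 1" by (simp only: x y circle_eq)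
  show y1: "0 < j \<Longrightarrow> 0 < pattern_y M j \<and> pattern_y M j < 1"
    using t[of j] assms by (auto simp: y power_less_one_iff add_pos_nonneg divide_less_eq intro!: divide_pos_pos)
  have "0 < (1 - t j)\<^sup>2" if "0 < j" using t[of j] that assms by simp
  then show "0 < j \<Longrightarrow> 0 < pattern_x M j 0 \<and> pattern_x M j 0 < 1"
    using t[of j] assms
    by (auto simp: x add_pos_nonneg divide_less_eq power2_eq_square algebra_simps intro!: divide_pos_pos)
  show "0 < i \<Longrightarrow> i < j \<Longrightarrow> pattern_x M i 0 < pattern_x M j 0"
    using circle_strict_mono(1)[of "t i" "t j"] t[of i] t[of j] assms by (simp add: x)
  show "i < j \<Longrightarrow> pattern_y M j < pattern_y M i"
  proof (cases "i = 0")
    case True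
    assume "i < j"
    then show ?thesis using y1 True by (simp add: pattern_y_def)
  next
    case False
    assume "i < j"
    then show ?thesis using circle_strict_mono(2)[of "t i" "t j"] t[of i] t[of j] assms False by (simp add: y)
  qed
qed

lemma pattern_x_inj:
  assumes "i < M" "j < M" "i \<noteq> j"
  shows "pattern_x M i 0 \<noteq> pattern_x M j 0"
proof -
  have "pattern_x M i 0 \<noteq> pattern_x M j 0" if "i < j" "j < M" for i j
    using that pattern_props(3)[of j M] pattern_props(4)[of j M i]
    by (cases "i = 0") (auto simp: pattern_x_def[of M 0])
  then show ?thesis using assms by (metis linorder_neqE_nat)
qed

lemma pattern_y_inj:
  assumes "i < M" "j < M" "i \<noteq> j"
  shows "pattern_y M i \<noteq> pattern_y M j"
  using pattern_props(5)[of i M j] pattern_props(5)[of j M i] assms by (cases "i < j") auto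

text \<open>\<open>pattern_y\<close> decreases in its index and \<open>rearrange\<close> lowers a
  positive index off \<open>D\<close>, so such a point is lifted vertically off the circle. Index 0
  already has abscissa 2.\<close>

lemma pattern_outside:
  assumes D: "D \<in> blocks d M" and j: "j < M" "j \<notin> D"
  shows "(pattern_x M j 0)\<^sup>2 + (pattern_y M (rearrange M D j))\<^sup>2 > 1"
proof (cases "j = 0")
  case True
  then have "(pattern_x M j 0)\<^sup>2 = 4" by (simp add: pattern_x_def)
  then show ?thesis using zero_le_power2[of "pattern_y M (rearrange M D j)"] by linarith
next
  case False
  then have "pattern_y M j < pattern_y M (rearrange M D j)" "0 < pattern_y M j"
    using rearrange_nonblock(2)[OF D j] pattern_props(2,5)[OF j(1)] by auto
  then have "(pattern_y M j)\<^sup>2 < (pattern_y M (rearrange M D j))\<^sup>2" by (intro power_strict_mono) auto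
  then show ?thesis using pattern_props(1)[OF j(1)] False by simp
qed

section \<open>The lift and its supporting hyperplanes\<close>

locale lifting =
  fixes d :: nat and e :: "nat \<Rightarrow> 'a::euclidean_space"
  assumes basis: "bij_betw e {..<d} Basis" and d_ge: "d \<ge> 5"
begin

lemma e_inner_e: "i < d \<Longrightarrow> j < d \<Longrightarrow> e i \<bullet> e j = (if i = j then 1 else 0)"
  using inner_Basis[of "e i" "e j"] bij_betw_apply[OF basis] bij_betw_imp_inj_on[OF basis]
  by (simp add: inj_on_eq_iff[of e "{..<d}"])

lemma inner_coords: "a \<bullet> b = (\<Sum>i<d. (a \<bullet> e i) * (b \<bullet> e i))"
  unfolding euclidean_inner[of a b] using sum.reindex_bij_betw[OF basis, of "\<lambda>u. (a \<bullet> u) * (b \<bullet> u)"]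
  by simp

lemma zero_coords: "a = 0 \<longleftrightarrow> (\<forall>i<d. a \<bullet> e i = 0)"
proof
  assume "\<forall>i<d. a \<bullet> e i = 0"
  then have "a \<bullet> a = 0" by (subst inner_coords) simp
  then show "a = 0" by simp
qed simp

text \<open>The extra coordinates are kept as further components of \<open>x\<close> because they
  are translated and rescaled together with the abscissa \<open>x 0\<close>.\<close>

definition lift :: "(nat \<Rightarrow> real) \<Rightarrow> real \<Rightarrow> 'a" where
  "lift x y = (\<Sum>i<d. (if i = 1 then (x 0)\<^sup>2 else if i = 2 then y else if i = 3 then y\<^sup>2 else x i) *\<^sub>R e i)"

lemma inner_sum_e: "i < d \<Longrightarrow> (\<Sum>j<d. c j *\<^sub>R e j) \<bullet> e i = c i"
  by (simp add: inner_sum_left e_inner_e if_distrib[of "(*) _"] sum.delta cong: if_cong)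

lemma lift_coord:
  "i < d \<Longrightarrow> lift x y \<bullet> e i = (if i = 1 then (x 0)\<^sup>2 else if i = 2 then y else if i = 3 then y\<^sup>2 else x i)"
  unfolding lift_def by (rule inner_sum_e)

lemma sum_split: "(\<Sum>i<d. f i) = f 0 + f 1 + f 2 + f 3 + (\<Sum>i=4..<d. f i)" for f :: "nat \<Rightarrow> real"
proof -
  have "{..<d} = {0, 1, 2, 3} \<union> {4..<d}" using d_ge by auto
  then show ?thesis by (simp add: sum.union_disjoint)
qed

lemma inner_lift:
  "a \<bullet> lift x y = (a \<bullet> e 0) * x 0 + (a \<bullet> e 1) * (x 0)\<^sup>2 + (a \<bullet> e 2) * y + (a \<bullet> e 3) * y\<^sup>2 +
    (\<Sum>i=4..<d. (a \<bullet> e i) * x i)"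
proof -
  have "(\<Sum>i=4..<d. (a \<bullet> e i) * (lift x y \<bullet> e i)) = (\<Sum>i=4..<d. (a \<bullet> e i) * x i)"
    by (rule sum.cong) (auto simp: lift_coord)
  then show ?thesis
    using d_ge by (simp add: inner_coords[of a "lift x y"] sum_split lift_coord)
qed

text \<open>The number \<open>c\<close> is a common margin for all the inequalities. Margin 0 is
  strict support; a positive margin is what compactness yields and what controls points far
  away.\<close>

definition supports :: "real \<Rightarrow> 'i set \<Rightarrow> ('i \<Rightarrow> 'a) \<Rightarrow> 'i set \<Rightarrow> 'a \<Rightarrow> real \<Rightarrow> bool" where
  "supports c I P F a b \<longleftrightarrow> a \<bullet> e 1 > c \<and> a \<bullet> e 3 > c \<and> (\<forall>v\<in>I - F. a \<bullet> P v > b + c)"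

text \<open>Quantifying over all hyperplanes through \<open>F\<close>, rather than asserting that one of them supports,
  makes the property stable under perturbation by compactness of the unit sphere. Positive
  coefficients of $x^2$ and $y^2$ keep far away points on the right side.\<close>
definition strict_facet :: "'i set \<Rightarrow> ('i \<Rightarrow> 'a) \<Rightarrow> 'i set \<Rightarrow> bool" where
  "strict_facet I P F \<longleftrightarrow> (\<forall>a b. (a, b) \<noteq> (0, 0) \<longrightarrow> (\<forall>v\<in>F. a \<bullet> P v = b) \<longrightarrow>
     supports 0 I P F a b \<or> supports 0 I P F (- a) (- b))"

section \<open>Stability of strict facets under perturbation, distant points and rescaling\<close>

lemma supports_scale:
  assumes "k > 0"
  shows "supports 0 I P F (k *\<^sub>R a) (k * b) \<longleftrightarrow> supports 0 I P F a b"
  using assms by (simp add: supports_def zero_less_mult_iff)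

lemma supports_eventually:
  assumes "finite I" and A: "A \<longlonglongrightarrow> a" and B: "B \<longlonglongrightarrow> b" and \<delta>: "\<delta> \<longlonglongrightarrow> 0"
    and Q: "\<And>v. v \<in> I \<Longrightarrow> (\<lambda>n. Q n v) \<longlonglongrightarrow> P v" and sup: "supports 0 I P F a b"
  shows "\<forall>\<^sub>F n in sequentially. supports (\<delta> n) I (Q n) F (A n) (B n)"
proof -
  have pos: "\<forall>\<^sub>F n in sequentially. A n \<bullet> e i - \<delta> n > 0" if "a \<bullet> e i > 0" for i
  proof -
    have "(\<lambda>n. A n \<bullet> e i - \<delta> n) \<longlonglongrightarrow> a \<bullet> e i - 0" by (intro tendsto_intros A \<delta>)
    then show ?thesis using that by (intro order_tendstoD(1)) auto
  qed
  have off: "\<forall>\<^sub>F n in sequentially. \<forall>v\<in>I - F. A n \<bullet> Q n v - B n - \<delta> n > 0"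
  proof (rule eventually_ball_finite)
    show "\<forall>v\<in>I - F. \<forall>\<^sub>F n in sequentially. A n \<bullet> Q n v - B n - \<delta> n > 0"
    proof
      fix v assume v: "v \<in> I - F"
      have "(\<lambda>n. A n \<bullet> Q n v - B n - \<delta> n) \<longlonglongrightarrow> a \<bullet> P v - b - 0"
        using v by (intro tendsto_intros A B \<delta> Q) auto
      then show "\<forall>\<^sub>F n in sequentially. A n \<bullet> Q n v - B n - \<delta> n > 0"
        using sup v by (intro order_tendstoD(1)) (auto simp: supports_def)
    qed
  qed (use assms(1) in auto)
  have "\<forall>\<^sub>F n in sequentially. A n \<bullet> e 1 - \<delta> n > 0 \<and> A n \<bullet> e 3 - \<delta> n > 0 \<and>
      (\<forall>v\<in>I - F. A n \<bullet> Q n v - B n - \<delta> n > 0)"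
    using sup off by (intro eventually_conj pos) (auto simp: supports_def)
  then show ?thesis
    by (rule eventually_mono) (auto simp: supports_def algebra_simps)
qed

text \<open>If no \<delta> worked, counterexamples for \<delta> = 1/(n+1) would have unit vectors
  (a, b) with a convergent subsequence. The limit is a hyperplane through the unperturbed
  \<open>F\<close>, hence strictly supporting up to sign, and finitely many strict inequalities
  persist along the subsequence.\<close>

lemma strict_facet_robust:
  assumes I: "finite I" and F: "F \<subseteq> I" and strict: "strict_facet I P F"
  obtains \<delta> where "\<delta> > 0"
    "\<And>Q a b. (\<And>v. v \<in> I \<Longrightarrow> dist (Q v) (P v) < \<delta>) \<Longrightarrow> norm (a, b) = 1 \<Longrightarrow>
      (\<And>v. v \<in> F \<Longrightarrow> a \<bullet> Q v = b) \<Longrightarrow> supports \<delta> I Q F a b \<or> supports \<delta> I Q F (- a) (- b)"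
proof -
  have "\<exists>\<delta>>0. \<forall>Q a b. (\<forall>v\<in>I. dist (Q v) (P v) < \<delta>) \<longrightarrow> norm (a, b) = 1 \<longrightarrow>
      (\<forall>v\<in>F. a \<bullet> Q v = b) \<longrightarrow> supports \<delta> I Q F a b \<or> supports \<delta> I Q F (- a) (- b)"
  proof (rule ccontr)
    assume neg: "\<not> ?thesis"
    define \<delta> where "\<delta> n = 1 / real (Suc n)" for n
    have "\<delta> n > 0" for n by (simp add: \<delta>_def)
    then have "\<forall>n. \<exists>z. (\<forall>v\<in>I. dist (fst z v) (P v) < \<delta> n) \<and> norm (snd z) = 1 \<and>
      (\<forall>v\<in>F. fst (snd z) \<bullet> fst z v = snd (snd z)) \<and>
      \<not> supports (\<delta> n) I (fst z) F (fst (snd z)) (snd (snd z)) \<and>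
      \<not> supports (\<delta> n) I (fst z) F (- fst (snd z)) (- snd (snd z))"
      using neg by fastforce
    then obtain z where z: "\<And>n v. v \<in> I \<Longrightarrow> dist (fst (z n) v) (P v) < \<delta> n"
      "\<And>n. norm (snd (z n)) = 1"
      "\<And>n v. v \<in> F \<Longrightarrow> fst (snd (z n)) \<bullet> fst (z n) v = snd (snd (z n))"
      "\<And>n. \<not> supports (\<delta> n) I (fst (z n)) F (fst (snd (z n))) (snd (snd (z n)))"
      "\<And>n. \<not> supports (\<delta> n) I (fst (z n)) F (- fst (snd (z n))) (- snd (snd (z n)))"
      by metis
    have "compact (sphere (0::'a \<times> real) 1)" by simp
    moreover have "\<forall>n. snd (z n) \<in> sphere 0 1" using z(2) by simp
    ultimately obtain ab r where ab: "ab \<in> sphere 0 1" and r: "strict_mono (r :: nat \<Rightarrow> nat)"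
      and lim: "((\<lambda>n. snd (z n)) \<circ> r) \<longlonglongrightarrow> ab"
      unfolding compact_def by metis
    obtain a b where [simp]: "ab = (a, b)" by fastforce
    have \<delta>0: "\<delta> \<longlonglongrightarrow> 0" unfolding \<delta>_def using LIMSEQ_inverse_real_of_nat by (simp add: inverse_eq_divide)
    have \<delta>: "(\<lambda>n. \<delta> (r n)) \<longlonglongrightarrow> 0" using LIMSEQ_subseq_LIMSEQ[OF \<delta>0 r] by (simp add: o_def)
    have A: "(\<lambda>n. fst (snd (z (r n)))) \<longlonglongrightarrow> a" and B: "(\<lambda>n. snd (snd (z (r n)))) \<longlonglongrightarrow> b"
      using tendsto_fst[OF lim] tendsto_snd[OF lim] by (simp_all add: o_def)
    have Q: "(\<lambda>n. fst (z (r n)) v) \<longlonglongrightarrow> P v" if "v \<in> I" for v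
    proof (rule tendstoI)
      fix \<epsilon> :: real assume "\<epsilon> > 0"
      then have "\<forall>\<^sub>F n in sequentially. \<delta> (r n) < \<epsilon>" using \<delta> by (intro order_tendstoD(2)) auto
      then show "\<forall>\<^sub>F n in sequentially. dist (fst (z (r n)) v) (P v) < \<epsilon>"
        by (rule eventually_mono) (use z(1)[OF that] in \<open>meson order_less_trans\<close>)
    qed
    have "a \<bullet> P v = b" if "v \<in> F" for v
    proof -
      have "(\<lambda>n. fst (snd (z (r n))) \<bullet> fst (z (r n)) v) \<longlonglongrightarrow> a \<bullet> P v"
        using that F by (intro tendsto_intros A Q) auto
      then show ?thesis using z(3)[OF that] B by (simp add: LIMSEQ_unique)
    qed
    moreover have "(a, b) \<noteq> (0, 0)" using ab by auto
    ultimately consider "supports 0 I P F a b" | "supports 0 I P F (- a) (- b)"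
      using strict unfolding strict_facet_def by blast
    then show False
    proof cases
      case 1
      from supports_eventually[OF I A B \<delta> Q this] show False
        using z(4) by (auto simp: eventually_sequentially)
    next
      case 2
      from supports_eventually[OF I tendsto_minus[OF A] tendsto_minus[OF B] \<delta> Q this] show False
        using z(5) by (auto simp: eventually_sequentially)
    qed
  qed
  then show ?thesis using that by metis
qed

lemma strict_facetI:
  assumes "\<And>a b. norm (a, b) = 1 \<Longrightarrow> (\<And>v. v \<in> F \<Longrightarrow> a \<bullet> P v = b) \<Longrightarrow>
    supports 0 I P F a b \<or> supports 0 I P F (- a) (- b)"
  shows "strict_facet I P F"
  unfolding strict_facet_def
proof (intro allI impI)
  fix a b assume ab: "(a, b) \<noteq> (0::'a, 0::real)" "\<forall>v\<in>F. a \<bullet> P v = b"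
  define k where "k = inverse (norm (a, b))"
  have "norm (a, b) > 0" using ab(1) by (simp add: zero_prod_def[symmetric])
  then have k: "k > 0" "\<bar>k\<bar> * norm (a, b) = 1" unfolding k_def by (auto simp del: norm_Pair)
  then have "norm (k *\<^sub>R (a, b)) = 1" unfolding norm_scaleR by blast
  then have "norm (k *\<^sub>R a, k * b) = 1" by simp
  then have "supports 0 I P F (k *\<^sub>R a) (k * b) \<or> supports 0 I P F (- (k *\<^sub>R a)) (- (k * b))"
    using ab(2) by (intro assms) auto
  then show "supports 0 I P F a b \<or> supports 0 I P F (- a) (- b)"
    using supports_scale[OF k(1), of I P F a b] supports_scale[OF k(1), of I P F "- a" "- b"] by simp
qed

lemma supports_mono: "supports c I P F a b \<Longrightarrow> c' \<le> c \<Longrightarrow> supports c' I P F a b"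
  by (force simp: supports_def)

lemma strict_facet_perturb:
  assumes "finite I" "F \<subseteq> I" "strict_facet I P F"
  shows "\<exists>\<delta>>0. \<forall>Q. (\<forall>v\<in>I. dist (Q v) (P v) < \<delta>) \<longrightarrow> strict_facet I Q F"
proof -
  obtain \<delta> where \<delta>: "\<delta> > 0" and rob:
    "\<And>Q a b. (\<And>v. v \<in> I \<Longrightarrow> dist (Q v) (P v) < \<delta>) \<Longrightarrow> norm (a, b) = 1 \<Longrightarrow>
      (\<And>v. v \<in> F \<Longrightarrow> a \<bullet> Q v = b) \<Longrightarrow> supports \<delta> I Q F a b \<or> supports \<delta> I Q F (- a) (- b)"
    using strict_facet_robust[OF assms] by blast
  show ?thesis
  proof (intro exI[of _ \<delta>] conjI allI impI strict_facetI)
    fix Q a b assume "\<forall>v\<in>I. dist (Q v) (P v) < \<delta>" "norm (a, b) = 1" "\<And>v. v \<in> F \<Longrightarrow> a \<bullet> Q v = b"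
    then have "supports \<delta> I Q F a b \<or> supports \<delta> I Q F (- a) (- b)" using rob by blast
    then show "supports 0 I Q F a b \<or> supports 0 I Q F (- a) (- b)"
      using supports_mono \<delta> less_imp_le by blast
  qed (rule \<delta>)
qed

text \<open>For a normalised hyperplane all coefficients are at most 1 in absolute value, while
  those of the two squares are at least \<delta>. At a distant point the squares grow quadratically
  and the other coordinates at most linearly, so the squares win uniformly over all hyperplanes
  through \<open>F\<close>.\<close>

lemma strict_facet_extend:
  assumes I: "finite I" "F \<subseteq> I" "strict_facet I P F" and J: "finite J"
    and near: "\<And>v. v \<in> I \<Longrightarrow> (\<lambda>n. Q n v) \<longlonglongrightarrow> P v"
    and nonneg: "\<And>w n. w \<in> J - I \<Longrightarrow> Q n w \<bullet> e 1 \<ge> 0 \<and> Q n w \<bullet> e 3 \<ge> 0"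
    and linear: "\<And>w i. w \<in> J - I \<Longrightarrow> i < d \<Longrightarrow> i \<noteq> 1 \<Longrightarrow> i \<noteq> 3 \<Longrightarrow>
      (\<lambda>n. (Q n w \<bullet> e i) / real (Suc n)) \<longlonglongrightarrow> \<alpha> w i"
    and quadratic: "\<And>w. w \<in> J - I \<Longrightarrow>
      (\<lambda>n. (Q n w \<bullet> e 1 + Q n w \<bullet> e 3) / (real (Suc n))\<^sup>2) \<longlonglongrightarrow> \<gamma> w"
    and pos: "\<And>w. w \<in> J - I \<Longrightarrow> \<gamma> w > 0"
  shows "\<forall>\<^sub>F n in sequentially. strict_facet (I \<union> J) (Q n) F"
proof -
  obtain \<delta> where \<delta>: "\<delta> > 0" and rob:
    "\<And>Q a b. (\<And>v. v \<in> I \<Longrightarrow> dist (Q v) (P v) < \<delta>) \<Longrightarrow> norm (a, b) = 1 \<Longrightarrow>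
      (\<And>v. v \<in> F \<Longrightarrow> a \<bullet> Q v = b) \<Longrightarrow> supports \<delta> I Q F a b \<or> supports \<delta> I Q F (- a) (- b)"
    using strict_facet_robust[OF I] by blast
  define K where "K = {..<d} - {1, 3}"
  have close: "\<forall>\<^sub>F n in sequentially. \<forall>v\<in>I. dist (Q n v) (P v) < \<delta>"
    using I(1) near \<delta> by (intro eventually_ball_finite) (auto intro: tendstoD)
  have far: "\<forall>\<^sub>F n in sequentially. \<forall>w\<in>J - I.
      1 + (\<Sum>i\<in>K. \<bar>Q n w \<bullet> e i\<bar>) < \<delta> * (Q n w \<bullet> e 1 + Q n w \<bullet> e 3)"
  proof (rule eventually_ball_finite)
    show "\<forall>w\<in>J - I. \<forall>\<^sub>F n in sequentially.
        1 + (\<Sum>i\<in>K. \<bar>Q n w \<bullet> e i\<bar>) < \<delta> * (Q n w \<bullet> e 1 + Q n w \<bullet> e 3)"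
    proof
      fix w assume w: "w \<in> J - I"
      let ?N = "\<lambda>n. real (Suc n)"
      have "(\<lambda>n. 1 / ?N n) \<longlonglongrightarrow> 0" using LIMSEQ_inverse_real_of_nat by (simp add: inverse_eq_divide)
      moreover from this
      have "(\<lambda>n. 1 / ?N n * (1 / ?N n + (\<Sum>i\<in>K. \<bar>(Q n w \<bullet> e i) / ?N n\<bar>))) \<longlonglongrightarrow>
          0 * (0 + (\<Sum>i\<in>K. \<bar>\<alpha> w i\<bar>))"
        using w by (intro tendsto_intros linear) (auto simp: K_def)
      ultimately have "(\<lambda>n. \<delta> * ((Q n w \<bullet> e 1 + Q n w \<bullet> e 3) / (?N n)\<^sup>2) -
          1 / ?N n * (1 / ?N n + (\<Sum>i\<in>K. \<bar>(Q n w \<bullet> e i) / ?N n\<bar>))) \<longlonglongrightarrow>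
          \<delta> * \<gamma> w - 0 * (0 + (\<Sum>i\<in>K. \<bar>\<alpha> w i\<bar>))"
        using w by (intro tendsto_diff tendsto_mult_left quadratic) auto
      from order_tendstoD(1)[OF this, of 0] have "\<forall>\<^sub>F n in sequentially. \<delta> * ((Q n w \<bullet> e 1 + Q n w \<bullet> e 3) / (?N n)\<^sup>2) -
          1 / ?N n * (1 / ?N n + (\<Sum>i\<in>K. \<bar>(Q n w \<bullet> e i) / ?N n\<bar>)) > 0"
        using pos[OF w] \<delta> by (simp del: of_nat_Suc)
      then show "\<forall>\<^sub>F n in sequentially.
        1 + (\<Sum>i\<in>K. \<bar>Q n w \<bullet> e i\<bar>) < \<delta> * (Q n w \<bullet> e 1 + Q n w \<bullet> e 3)"
      proof (rule eventually_mono)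
        fix n
        assume "\<delta> * ((Q n w \<bullet> e 1 + Q n w \<bullet> e 3) / (?N n)\<^sup>2) -
          1 / ?N n * (1 / ?N n + (\<Sum>i\<in>K. \<bar>(Q n w \<bullet> e i) / ?N n\<bar>)) > 0"
        also have "(\<Sum>i\<in>K. \<bar>(Q n w \<bullet> e i) / ?N n\<bar>) = (\<Sum>i\<in>K. \<bar>Q n w \<bullet> e i\<bar>) / ?N n"
          by (simp add: abs_divide sum_divide_distrib)
        finally have "(\<delta> * (Q n w \<bullet> e 1 + Q n w \<bullet> e 3) - (1 + (\<Sum>i\<in>K. \<bar>Q n w \<bullet> e i\<bar>))) / (?N n)\<^sup>2 > 0"
          by (simp add: diff_divide_distrib add_divide_distrib power2_eq_square distrib_left)
        then show "1 + (\<Sum>i\<in>K. \<bar>Q n w \<bullet> e i\<bar>) < \<delta> * (Q n w \<bullet> e 1 + Q n w \<bullet> e 3)"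
          by (simp add: zero_less_divide_iff)
      qed
    qed
  qed (use J in auto)
  have ext: "supports 0 (I \<union> J) (Q n) F a b"
    if sup: "supports \<delta> I (Q n) F a b" and norm: "norm (a, b) = 1"
      and far: "\<forall>w\<in>J - I. 1 + (\<Sum>i\<in>K. \<bar>Q n w \<bullet> e i\<bar>) < \<delta> * (Q n w \<bullet> e 1 + Q n w \<bullet> e 3)"
    for n a b
  proof -
    have a1: "\<bar>a \<bullet> e i\<bar> \<le> 1" if "i < d" for i
    proof -
      have "\<bar>a \<bullet> e i\<bar> \<le> norm a * norm (e i)" by (rule Cauchy_Schwarz_ineq2)
      also have "norm (e i) = 1" using e_inner_e[of i i] that by (simp add: norm_eq_1)
      finally show ?thesis using norm_fst_le[of a b] norm by simp
    qed
    have b1: "b \<le> 1" using norm_snd_le[of b a] norm by simp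
    have far': "a \<bullet> Q n w > b" if w: "w \<in> J - I" for w
    proof -
      let ?q = "Q n w"
      have "{..<d} = K \<union> {1, 3}" "K \<inter> {1, 3} = {}" "finite K" using d_ge by (auto simp: K_def)
      then have "a \<bullet> ?q = (\<Sum>i\<in>K. (a \<bullet> e i) * (?q \<bullet> e i)) + ((a \<bullet> e 1) * (?q \<bullet> e 1) + (a \<bullet> e 3) * (?q \<bullet> e 3))"
        by (simp add: inner_coords[of a ?q] sum.union_disjoint)
      moreover have "(\<Sum>i\<in>K. (a \<bullet> e i) * (?q \<bullet> e i)) \<ge> - (\<Sum>i\<in>K. \<bar>?q \<bullet> e i\<bar>)"
        unfolding sum_negf[symmetric]
      proof (rule sum_mono)
        fix i assume "i \<in> K"
        then have "\<bar>a \<bullet> e i\<bar> * \<bar>?q \<bullet> e i\<bar> \<le> 1 * \<bar>?q \<bullet> e i\<bar>" using a1 by (intro mult_right_mono) (auto simp: K_def)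
        then have "\<bar>(a \<bullet> e i) * (?q \<bullet> e i)\<bar> \<le> \<bar>?q \<bullet> e i\<bar>" by (simp add: abs_mult)
        then show "- \<bar>?q \<bullet> e i\<bar> \<le> (a \<bullet> e i) * (?q \<bullet> e i)" by linarith
      qed
      moreover have "\<delta> * (?q \<bullet> e 1) \<le> (a \<bullet> e 1) * (?q \<bullet> e 1)" "\<delta> * (?q \<bullet> e 3) \<le> (a \<bullet> e 3) * (?q \<bullet> e 3)"
        using sup nonneg[OF w, of n] by (auto simp: supports_def intro!: mult_right_mono)
      ultimately show ?thesis using far[rule_format, OF w] b1 by (simp add: distrib_left)
    qed
    have near': "a \<bullet> Q n v > b" if "v \<in> I - F" for v
    proof -
      have "a \<bullet> Q n v > b + \<delta>" using sup that unfolding supports_def by blast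
      then show ?thesis using \<delta> by simp
    qed
    have "a \<bullet> Q n v > b" if "v \<in> (I \<union> J) - F" for v
      using near'[of v] far'[of v] that by blast
    moreover have "a \<bullet> e 1 > 0" "a \<bullet> e 3 > 0" using sup \<delta> by (auto simp: supports_def)
    ultimately show ?thesis unfolding supports_def by simp
  qed
  show ?thesis
    using close far
  proof (rule eventually_elim2)
    fix n
    assume close: "\<forall>v\<in>I. dist (Q n v) (P v) < \<delta>"
      and far: "\<forall>w\<in>J - I. 1 + (\<Sum>i\<in>K. \<bar>Q n w \<bullet> e i\<bar>) < \<delta> * (Q n w \<bullet> e 1 + Q n w \<bullet> e 3)"
    show "strict_facet (I \<union> J) (Q n) F"
    proof (rule strict_facetI)
      fix a b assume ab: "norm (a, b) = 1" "\<And>v. v \<in> F \<Longrightarrow> a \<bullet> Q n v = b"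
      have "norm (- a, - b) = 1" using ab(1) by (simp add: norm_Pair)
      then show "supports 0 (I \<union> J) (Q n) F a b \<or> supports 0 (I \<union> J) (Q n) F (- a) (- b)"
        using rob[of "Q n" a b] close ab ext far by blast
    qed
  qed
qed

lemma strict_facet_extend_lift:
  assumes I: "finite I" "F \<subseteq> I" "strict_facet I (\<lambda>v. lift (x v) (y v)) F" and J: "finite J"
    and near: "\<And>v i. v \<in> I \<Longrightarrow> i < d \<Longrightarrow> (\<lambda>n. X n v i) \<longlonglongrightarrow> x v i"
      "\<And>v. v \<in> I \<Longrightarrow> (\<lambda>n. Y n v) \<longlonglongrightarrow> y v"
    and far: "\<And>w i. w \<in> J - I \<Longrightarrow> i < d \<Longrightarrow> (\<lambda>n. X n w i / real (Suc n)) \<longlonglongrightarrow> \<alpha> w i"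
      "\<And>w. w \<in> J - I \<Longrightarrow> (\<lambda>n. Y n w / real (Suc n)) \<longlonglongrightarrow> \<beta> w"
      "\<And>w. w \<in> J - I \<Longrightarrow> \<alpha> w 0 \<noteq> 0 \<or> \<beta> w \<noteq> 0"
  shows "\<forall>\<^sub>F n in sequentially. strict_facet (I \<union> J) (\<lambda>w. lift (X n w) (Y n w)) F"
proof (rule strict_facet_extend[OF I J, where \<alpha> = "\<lambda>w i. if i = 2 then \<beta> w else \<alpha> w i"
      and \<gamma> = "\<lambda>w. (\<alpha> w 0)\<^sup>2 + (\<beta> w)\<^sup>2"])
  have d: "0 < d" "1 < d" "2 < d" "3 < d" using d_ge by auto
  show "(\<lambda>n. lift (X n v) (Y n v)) \<longlonglongrightarrow> lift (x v) (y v)" if "v \<in> I" for v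
    unfolding lift_def using that d
    by (intro tendsto_sum tendsto_scaleR tendsto_const)
      (auto intro!: near tendsto_power)
  show "0 \<le> lift (X n w) (Y n w) \<bullet> e 1 \<and> 0 \<le> lift (X n w) (Y n w) \<bullet> e 3" for w n
    using d by (simp add: lift_coord)
  show "(\<lambda>n. lift (X n w) (Y n w) \<bullet> e i / real (Suc n)) \<longlonglongrightarrow> (if i = 2 then \<beta> w else \<alpha> w i)"
    if "w \<in> J - I" "i < d" "i \<noteq> 1" "i \<noteq> 3" for w i
    using far(1,2)[OF that(1)] that by (auto simp: lift_coord)
  show "(\<lambda>n. (lift (X n w) (Y n w) \<bullet> e 1 + lift (X n w) (Y n w) \<bullet> e 3) / (real (Suc n))\<^sup>2)
      \<longlonglongrightarrow> (\<alpha> w 0)\<^sup>2 + (\<beta> w)\<^sup>2" if "w \<in> J - I" for w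
  proof -
    have "(\<lambda>n. (X n w 0 / real (Suc n))\<^sup>2 + (Y n w / real (Suc n))\<^sup>2) \<longlonglongrightarrow> (\<alpha> w 0)\<^sup>2 + (\<beta> w)\<^sup>2"
      using that d by (intro tendsto_intros far) auto
    then show ?thesis using d by (simp add: lift_coord power_divide add_divide_distrib del: of_nat_Suc)
  qed
  show "(\<alpha> w 0)\<^sup>2 + (\<beta> w)\<^sup>2 > 0" if "w \<in> J - I" for w
    using far(3)[OF that] by (simp add: sum_power2_gt_zero_iff)
qed

text \<open>Rescaling each axis acts on the lift as an affine map, so hyperplanes can be pulled
  back. The coefficients of the squares are multiplied by s^2 and t^2 and keep their signs; the
  cross terms of the expanded squares go into the linear coefficients.\<close>

lemma strict_facet_affine:
  assumes strict: "strict_facet I (\<lambda>v. lift (x v) (y v)) F" and F: "F \<subseteq> I" and st: "s > 0" "t > 0"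
    and X: "\<And>v i. v \<in> I \<Longrightarrow> X v i = \<alpha> i + s * x v i"
    and Y: "\<And>v. v \<in> I \<Longrightarrow> Y v = \<beta> + t * y v"
  shows "strict_facet I (\<lambda>v. lift (X v) (Y v)) F"
  unfolding strict_facet_def
proof (intro allI impI)
  fix a b assume nz: "(a, b) \<noteq> (0::'a, 0::real)" and F0: "\<forall>v\<in>F. a \<bullet> lift (X v) (Y v) = b"
  define c where "c i = (if i = 0 then s * (a \<bullet> e 0 + 2 * \<alpha> 0 * (a \<bullet> e 1)) else if i = 1 then s\<^sup>2 * (a \<bullet> e 1)
    else if i = 2 then t * (a \<bullet> e 2 + 2 * \<beta> * (a \<bullet> e 3)) else if i = 3 then t\<^sup>2 * (a \<bullet> e 3)
    else s * (a \<bullet> e i))" for i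
  define a' where "a' = (\<Sum>i<d. c i *\<^sub>R e i)"
  define b' where "b' = b - a \<bullet> lift \<alpha> \<beta>"
  have c: "a' \<bullet> e i = c i" if "i < d" for i unfolding a'_def by (rule inner_sum_e[OF that])
  have d: "0 < d" "1 < d" "2 < d" "3 < d" using d_ge by auto
  have eq: "a' \<bullet> lift (x v) (y v) - b' = a \<bullet> lift (X v) (Y v) - b" if "v \<in> I" for v
  proof -
    have "(\<Sum>i=4..<d. (a \<bullet> e i) * X v i) = (\<Sum>i=4..<d. (a \<bullet> e i) * \<alpha> i) + (\<Sum>i=4..<d. (a' \<bullet> e i) * x v i)"
      unfolding sum.distrib[symmetric]
      by (rule sum.cong) (use X[OF that] in \<open>auto simp: c c_def algebra_simps\<close>)
    then show ?thesis
      using d by (simp add: inner_lift b'_def X[OF that] Y[OF that] c)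
        (simp add: c_def algebra_simps power2_eq_square)
  qed
  have "(a', b') \<noteq> (0, 0)"
  proof
    assume 0: "(a', b') = (0, 0)"
    then have c0: "c i = 0" if "i < d" for i using c[OF that] by simp
    have "a \<bullet> e 1 = 0" "a \<bullet> e 3 = 0" using c0[of 1] c0[of 3] st d by (auto simp: c_def)
    then have "a \<bullet> e i = 0" if "i < d" for i
      using c0[OF that] st by (auto simp: c_def split: if_splits)
    then have "a = 0" using zero_coords by blast
    then show False using nz 0 by (simp add: b'_def)
  qed
  moreover have "\<forall>v\<in>F. a' \<bullet> lift (x v) (y v) = b'" using eq F F0 by fastforce
  ultimately have "supports 0 I (\<lambda>v. lift (x v) (y v)) F a' b' \<or> supports 0 I (\<lambda>v. lift (x v) (y v)) F (- a') (- b')"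
    using strict unfolding strict_facet_def by blast
  moreover have ae: "a' \<bullet> e 1 = s\<^sup>2 * (a \<bullet> e 1)" "a' \<bullet> e 3 = t\<^sup>2 * (a \<bullet> e 3)" using d by (simp_all add: c c_def)
  moreover have "supports 0 I (\<lambda>v. lift (x v) (y v)) F a' b' \<longleftrightarrow> supports 0 I (\<lambda>v. lift (X v) (Y v)) F a b"
  proof -
    have "a' \<bullet> lift (x v) (y v) > b' + 0 \<longleftrightarrow> a \<bullet> lift (X v) (Y v) > b + 0" if "v \<in> I - F" for v
      using eq[of v] that by auto
    then show ?thesis unfolding supports_def ae using st by (simp add: zero_less_mult_iff)
  qed
  moreover have "supports 0 I (\<lambda>v. lift (x v) (y v)) F (- a') (- b') \<longleftrightarrow>
      supports 0 I (\<lambda>v. lift (X v) (Y v)) F (- a) (- b)"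
  proof -
    have "(- a') \<bullet> lift (x v) (y v) > - b' + 0 \<longleftrightarrow> (- a) \<bullet> lift (X v) (Y v) > - b + 0" if "v \<in> I - F" for v
      using eq[of v] that by auto
    then show ?thesis unfolding supports_def inner_minus_left ae using st by (simp add: mult_less_0_iff)
  qed
  ultimately show "supports 0 I (\<lambda>v. lift (X v) (Y v)) F a b \<or> supports 0 I (\<lambda>v. lift (X v) (Y v)) F (- a) (- b)"
    by blast
qed

lemma strict_facet_reindex:
  assumes "inj_on g I" "F \<subseteq> I"
  shows "strict_facet (g ` I) P (g ` F) \<longleftrightarrow> strict_facet I (\<lambda>v. P (g v)) F"
proof -
  have "g ` I - g ` F = g ` (I - F)" using inj_on_image_set_diff[OF assms(1)] assms(2) by auto
  then show ?thesis by (simp add: strict_facet_def supports_def)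
qed

lemma pattern_strict:
  assumes D: "D \<in> blocks d M"
  shows "strict_facet {..<M} (\<lambda>j. lift (pattern_x M j) (pattern_y M (rearrange M D j))) D"
  unfolding strict_facet_def
proof (intro allI impI)
  fix a b
  assume nz: "(a, b) \<noteq> (0::'a, 0::real)"
    and on: "\<forall>j\<in>D. a \<bullet> lift (pattern_x M j) (pattern_y M (rearrange M D j)) = b"
  define A where "A i = a \<bullet> e i" for i
  define t where "t j = real j / real M" for j
  \<comment> \<open>Coefficients in t of the hyperplane equation on the circle, multiplied by (1 +
    t^2)^2.\<close>
  define c where "c i = (if i = 0 then A 2 + A 3 - b else if i = 1 then 2 * A 0 + A 4
    else if i = 2 then 4 * A 1 - 2 * A 3 - 2 * b else if i = 3 then 2 * A 0
    else if i = 4 then A 3 - A 2 - b else A i)" for i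
  have Dj: "0 < j \<and> j < M" if "j \<in> D" for j using that D by (auto simp: blocks_def)
  have root: "(\<Sum>i\<le>d - 1. c i * t j ^ i) = 0" if j: "j \<in> D" for j
  proof -
    let ?q = "1 + (t j)\<^sup>2"
    have q: "?q > 0" by (auto intro: add_pos_nonneg)
    have j0: "j \<noteq> 0" using Dj[OF j] by simp
    have "rearrange M D j = j" using j by (simp add: rearrange_def)
    then have "a \<bullet> lift (pattern_x M j) (pattern_y M j) = b" using on j by force
    moreover have "(\<Sum>i=4..<d. A i * pattern_x M j i) = A 4 * (t j / ?q\<^sup>2) + (\<Sum>i=5..<d. A i * (t j ^ i / ?q\<^sup>2))"
    proof -
      have "{4..<d} = insert 4 {5..<d}" using d_ge by auto
      moreover have "(\<Sum>i=5..<d. A i * pattern_x M j i) = (\<Sum>i=5..<d. A i * (t j ^ i / ?q\<^sup>2))"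
        by (rule sum.cong) (use j0 in \<open>auto simp: pattern_x_def t_def Let_def\<close>)
      ultimately show ?thesis using j0 by (simp add: pattern_x_def t_def Let_def)
    qed
    ultimately have "A 0 * (2 * t j / ?q) + A 1 * (2 * t j / ?q)\<^sup>2 + A 2 * ((1 - (t j)\<^sup>2) / ?q)
        + A 3 * ((1 - (t j)\<^sup>2) / ?q)\<^sup>2
        + (A 4 * (t j / ?q\<^sup>2) + (\<Sum>i=5..<d. A i * (t j ^ i / ?q\<^sup>2))) = b"
      using j0 by (simp add: inner_lift A_def[symmetric])
        (simp add: pattern_x_def pattern_y_def t_def Let_def)
    then have "b * ?q\<^sup>2 = (A 0 * (2 * t j / ?q)) * ?q\<^sup>2 + (A 1 * (2 * t j / ?q)\<^sup>2) * ?q\<^sup>2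
        + (A 2 * ((1 - (t j)\<^sup>2) / ?q)) * ?q\<^sup>2 + (A 3 * ((1 - (t j)\<^sup>2) / ?q)\<^sup>2) * ?q\<^sup>2
        + (A 4 * (t j / ?q\<^sup>2)) * ?q\<^sup>2 + (\<Sum>i=5..<d. A i * (t j ^ i / ?q\<^sup>2)) * ?q\<^sup>2"
      by (simp only: distrib_right[symmetric] add.assoc)
    also have "(A 0 * (2 * t j / ?q)) * ?q\<^sup>2 = A 0 * 2 * t j * ?q" using q by (simp add: power2_eq_square)
    also have "(A 1 * (2 * t j / ?q)\<^sup>2) * ?q\<^sup>2 = A 1 * 4 * (t j)\<^sup>2" using q by (simp add: power_divide power_mult_distrib)
    also have "(A 2 * ((1 - (t j)\<^sup>2) / ?q)) * ?q\<^sup>2 = A 2 * (1 - (t j)\<^sup>2) * ?q" using q by (simp add: power2_eq_square)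
    also have "(A 3 * ((1 - (t j)\<^sup>2) / ?q)\<^sup>2) * ?q\<^sup>2 = A 3 * (1 - (t j)\<^sup>2)\<^sup>2" using q by (simp add: power_divide)
    also have "(A 4 * (t j / ?q\<^sup>2)) * ?q\<^sup>2 = A 4 * t j" using q by simp
    also have "(\<Sum>i=5..<d. A i * (t j ^ i / ?q\<^sup>2)) * ?q\<^sup>2 = (\<Sum>i=5..<d. A i * t j ^ i)"
      unfolding sum_distrib_right using q by (intro sum.cong) auto
    finally have main: "b * ?q\<^sup>2 = A 0 * 2 * t j * ?q + A 1 * 4 * (t j)\<^sup>2 + A 2 * (1 - (t j)\<^sup>2) * ?q
        + A 3 * (1 - (t j)\<^sup>2)\<^sup>2 + A 4 * t j + (\<Sum>i=5..<d. A i * t j ^ i)" .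
    have "{..d - 1} = {..<d}" using d_ge by auto
    then have "(\<Sum>i\<le>d - 1. c i * t j ^ i) = c 0 * t j ^ 0 + c 1 * t j ^ 1 + c 2 * t j ^ 2 + c 3 * t j ^ 3
        + (\<Sum>i=4..<d. c i * t j ^ i)" by (simp only: sum_split)
    also have "(\<Sum>i=4..<d. c i * t j ^ i) = c 4 * t j ^ 4 + (\<Sum>i=5..<d. A i * t j ^ i)"
    proof -
      have "{4..<d} = insert 4 {5..<d}" using d_ge by auto
      moreover have "(\<Sum>i=5..<d. c i * t j ^ i) = (\<Sum>i=5..<d. A i * t j ^ i)"
        by (rule sum.cong) (auto simp: c_def)
      ultimately show ?thesis by simp
    qed
    also have "c 0 * t j ^ 0 + c 1 * t j ^ 1 + c 2 * t j ^ 2 + c 3 * t j ^ 3 + (c 4 * t j ^ 4 + (\<Sum>i=5..<d. A i * t j ^ i))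
      = A 0 * 2 * t j * ?q + A 1 * 4 * (t j)\<^sup>2 + A 2 * (1 - (t j)\<^sup>2) * ?q
        + A 3 * (1 - (t j)\<^sup>2)\<^sup>2 + A 4 * t j + (\<Sum>i=5..<d. A i * t j ^ i) - b * ?q\<^sup>2"
      by (simp add: c_def algebra_simps power2_eq_square power3_eq_cube power4_eq_xxxx)
    finally show ?thesis using main by simp
  qed
  \<comment> \<open>The d distinct parameters of \<open>D\<close> are too many roots for a nonzero
    polynomial of degree at most d - 1.\<close>
  have c0: "c k = 0" if "k < d" for k
  proof (rule ccontr)
    assume k: "c k \<noteq> 0"
    have rb: "finite {z. (\<Sum>i\<le>d - 1. c i * z ^ i) = 0}" "card {z. (\<Sum>i\<le>d - 1. c i * z ^ i) = 0} \<le> d - 1"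
      using polyfun_rootbound[of "d - 1" c] k that by force+
    have "inj_on t D" using Dj by (force simp: inj_on_def t_def)
    then have "d = card (t ` D)" using D by (simp add: card_image blocks_def)
    also have "\<dots> \<le> card {z. (\<Sum>i\<le>d - 1. c i * z ^ i) = 0}" using root rb(1) by (intro card_mono) auto
    finally show False using rb(2) d_ge by simp
  qed
  \<comment> \<open>All five low coefficients must vanish, which requires \<open>4 < d\<close>.
    \<open>c 3\<close> kills \<open>A 0\<close>, then \<open>c 1\<close> kills \<open>A 4\<close>;
    \<open>c 0\<close> and \<open>c 4\<close> give \<open>A 2 = 0\<close> and
    \<open>b = A 3\<close>; \<open>c 2\<close> gives \<open>A 1 = A 3\<close>. What remains is a
    multiple of the circle equation.\<close>
  have d: "0 < d" "1 < d" "2 < d" "3 < d" "4 < d" using d_ge by auto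
  have A: "A 2 = 0" "b = A 3" "A 1 = A 3" "A 0 = 0" "A 4 = 0"
    using c0[OF d(1)] c0[OF d(2)] c0[OF d(3)] c0[OF d(4)] c0[OF d(5)] by (auto simp: c_def)
  have A4: "A i = 0" if "4 \<le> i" "i < d" for i
    using c0[OF that(2)] that A(5) by (auto simp: c_def split: if_splits)
  have val: "a \<bullet> lift x y = A 3 * ((x 0)\<^sup>2 + y\<^sup>2)" for x y
    using A A4 by (simp add: inner_lift A_def[symmetric] distrib_left)
  have "A 3 \<noteq> 0"
  proof
    assume 0: "A 3 = 0"
    have "A i = 0" if "i < d" for i
      using A A4 that 0 by (cases "4 \<le> i") (auto simp: not_le less_Suc_eq numeral_eq_Suc)
    then have "a = 0" using zero_coords unfolding A_def by blast
    then show False using nz A(2) 0 by simp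
  qed
  moreover have "supports 0 {..<M} (\<lambda>j. lift (pattern_x M j) (pattern_y M (rearrange M D j))) D a b" if "A 3 > 0"
    unfolding supports_def using that A pattern_outside[OF D] by (auto simp: val A_def[symmetric] mult_less_cancel_left1)
  moreover have "supports 0 {..<M} (\<lambda>j. lift (pattern_x M j) (pattern_y M (rearrange M D j))) D (- a) (- b)" if "A 3 < 0"
    unfolding supports_def using that A pattern_outside[OF D] by (auto simp: val A_def[symmetric] mult_less_cancel_left2)
  ultimately show "supports 0 {..<M} (\<lambda>j. lift (pattern_x M j) (pattern_y M (rearrange M D j))) D a b \<or>
      supports 0 {..<M} (\<lambda>j. lift (pattern_x M j) (pattern_y M (rearrange M D j))) D (- a) (- b)"
    by linarith
qed

lemma strict_facet_cong:
  assumes "\<And>v. v \<in> I \<Longrightarrow> P v = Q v" "F \<subseteq> I"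
  shows "strict_facet I P F \<longleftrightarrow> strict_facet I Q F"
proof -
  have "(\<forall>v\<in>F. a \<bullet> P v = b) \<longleftrightarrow> (\<forall>v\<in>F. a \<bullet> Q v = b)" for a b
    using assms(1) subsetD[OF assms(2)] by (intro ball_cong) auto
  moreover have "(\<forall>v\<in>I - F. a \<bullet> P v > b + c) \<longleftrightarrow> (\<forall>v\<in>I - F. a \<bullet> Q v > b + c)" for a b c
    using assms(1) by (intro ball_cong) auto
  ultimately show ?thesis unfolding strict_facet_def supports_def by (simp only:)
qed

lemma inverse_Suc_tendsto: "(\<lambda>n. c / real (Suc n)) \<longlonglongrightarrow> 0"
proof -
  have "(\<lambda>n. c * inverse (real (Suc n))) \<longlonglongrightarrow> c * 0"
    by (intro tendsto_intros LIMSEQ_inverse_real_of_nat)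
  then show ?thesis by (simp add: divide_inverse)
qed

section \<open>Realising the hypergraphs\<close>

text \<open>One \<open>y\<close> has to serve all trees: in the induction step the copies carry
  different trees, yet the old \<open>y\<close> of the tail is the leading part of the new ordinate
  in every copy. Injectivity of \<open>y\<close> separates the groups when one of them is
  magnified.\<close>

lemma embedding:
  "\<exists>(x :: tree \<Rightarrow> nat list \<Rightarrow> nat \<Rightarrow> real) y. inj_on y (words M L) \<and>
    (\<forall>T\<in>trees d M L. \<forall>F\<in>edges M L T. strict_facet (words M L) (\<lambda>w. lift (x T w) (y w)) F)"
proof (induction L)
  case 0
  show ?case by (intro exI[of _ "\<lambda>_ _ _. 0"] exI[of _ "\<lambda>_. 0"]) auto
next
  case (Suc L)
  then obtain x :: "tree \<Rightarrow> nat list \<Rightarrow> nat \<Rightarrow> real" and y where inj_y: "inj_on y (words M L)"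
    and IH: "\<And>T F. T \<in> trees d M L \<Longrightarrow> F \<in> edges M L T \<Longrightarrow>
      strict_facet (words M L) (\<lambda>w. lift (x T w) (y w)) F" by blast
  let ?W = "words M (Suc L)"
  let ?N = "\<lambda>n. real (Suc n)"
  \<comment> \<open>Inverts the rearrangement in the group of \<open>w\<close>, recovering the index
    of the copy that contains \<open>w\<close>.\<close>
  define copy where "copy D w = inv_into {..<M} (rearrange M (D (tl w))) (hd w)"
    for D :: "nat list \<Rightarrow> nat set" and w
  \<comment> \<open>The copy index leads in \<open>X\<close> and the tail leads in \<open>Y\<close>,
    with the other part scaled down by 1/(n+1): this is the reversed significance of digits.\<close>
  define X where "X n T w i = (case T of Leaf \<Rightarrow> 0 | Node D ch \<Rightarrow>
    pattern_x M (copy D w) i + x (ch (copy D w)) (tl w) i / ?N n)" for n T w i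
  define Y where "Y n w = y (tl w) + pattern_y M (hd w) / ?N n" for n w
  have tl: "tl (shifted M D j v) = v" and hd: "hd (shifted M D j v) = rearrange M (D v) j" for D j v
    by (simp_all add: shifted_def)
  have copy: "copy D (shifted M D j v) = j" if "D v \<in> blocks d M" "j < M" for D j v
    using that bij_betw_imp_inj_on[OF rearrange_bij[OF that(1)]] by (simp add: copy_def tl hd)
  have Xlim: "(\<lambda>n. X n (Node D ch) w i) \<longlonglongrightarrow> pattern_x M (copy D w) i" for D ch w i
    unfolding X_def using tendsto_add[OF tendsto_const inverse_Suc_tendsto] by simp
  have Ylim: "(\<lambda>n. Y n w) \<longlonglongrightarrow> y (tl w)" for w
    unfolding Y_def using tendsto_add[OF tendsto_const inverse_Suc_tendsto] by simp
  have small: "(\<lambda>n. f n / ?N n) \<longlonglongrightarrow> 0" if "f \<longlonglongrightarrow> l" for f l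
    using tendsto_mult[OF that LIMSEQ_inverse_real_of_nat] by (simp add: divide_inverse)
  \<comment> \<open>Magnifying \<open>y\<close> around \<open>y v\<close> shows the pattern and sends the other groups to infinity.\<close>
  have new: "\<forall>\<^sub>F n in sequentially. strict_facet ?W (\<lambda>w. lift (X n (Node D ch) w) (Y n w)) ((\<lambda>m. m # v) ` D v)"
    if D: "\<And>v. v \<in> words M L \<Longrightarrow> D v \<in> blocks d M" and v: "v \<in> words M L" for D ch v
  proof -
    let ?T = "Node D ch"
    define g where "g j = shifted M D j v" for j
    define I where "I = g ` {..<M}"
    define F where "F = g ` D v"
    have F_eq: "(\<lambda>m. m # v) ` D v = F" by (auto simp: F_def g_def shifted_def rearrange_def)
    have DM: "D v \<subseteq> {..<M}" using D[OF v] by (auto simp: blocks_def)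
    have g: "copy D (g j) = j" "tl (g j) = v" "hd (g j) = rearrange M (D v) j" if "j < M" for j
      using copy[of D v j] D[OF v] that by (simp_all add: g_def tl hd)
    have inj: "inj_on g {..<M}" by (rule inj_on_inverseI[of _ "copy D"]) (simp add: g)
    have IW: "I \<subseteq> ?W" using shifted_in_words[of v M L _ D d] v D by (auto simp: I_def g_def)
    have fin: "finite I" by (simp add: I_def)
    have FI: "F \<subseteq> I" using DM by (auto simp: F_def I_def)
    have base: "strict_facet I (\<lambda>w. lift (pattern_x M (copy D w)) (pattern_y M (hd w))) F"
      unfolding I_def F_def strict_facet_reindex[OF inj DM]
      by (rule strict_facet_cong[THEN iffD2, OF _ DM pattern_strict[OF D[OF v]]]) (simp add: g)
    have tl_ne: "tl w \<noteq> v \<and> tl w \<in> words M L" if w: "w \<in> ?W - I" for w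
    proof -
      obtain m v' where w': "w = m # v'" "m < M" "v' \<in> words M L" using w words_SucE by blast
      have "v' \<noteq> v"
      proof
        assume "v' = v"
        moreover obtain j where "j < M" "m = rearrange M (D v) j"
          using rearrange_bij[OF D[OF v]] w'(2) by (auto simp: bij_betw_def)
        ultimately have "w = g j" using w'(1) by (simp add: g_def shifted_def)
        then show False using w \<open>j < M\<close> by (auto simp: I_def)
      qed
      then show ?thesis using w' by simp
    qed
    have "\<forall>\<^sub>F n in sequentially. strict_facet (I \<union> ?W)
        (\<lambda>w. lift (X n ?T w) ((Y n w - y v) * ?N n)) F"
    proof (rule strict_facet_extend_lift[OF fin FI base, where \<alpha> = "\<lambda>_ _. 0" and \<beta> = "\<lambda>w. y (tl w) - y v"])
      show "(\<lambda>n. (Y n w - y v) * ?N n) \<longlonglongrightarrow> pattern_y M (hd w)" if "w \<in> I" for w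
      proof -
        have "(Y n w - y v) * ?N n = pattern_y M (hd w)" for n
          using that g(2) by (auto simp: I_def Y_def)
        then show ?thesis by simp
      qed
      show "(\<lambda>n. X n ?T w i / ?N n) \<longlonglongrightarrow> 0" for w i by (rule small[OF Xlim])
      show "(\<lambda>n. (Y n w - y v) * ?N n / ?N n) \<longlonglongrightarrow> y (tl w) - y v" for w
        using tendsto_diff[OF Ylim[of w] tendsto_const[of "y v"]] by simp
      show "0 \<noteq> (0::real) \<or> y (tl w) - y v \<noteq> 0" if "w \<in> ?W - I" for w
        using tl_ne[OF that] v inj_y by (auto simp: inj_on_def)
    qed (use Xlim in auto)
    then show ?thesis
      unfolding F_eq Un_absorb1[OF IW]
    proof (rule eventually_mono)
      fix n assume "strict_facet ?W (\<lambda>w. lift (X n ?T w) ((Y n w - y v) * ?N n)) F"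
      then show "strict_facet ?W (\<lambda>w. lift (X n ?T w) (Y n w)) F"
        by (rule strict_facet_affine[where \<alpha> = "\<lambda>_. 0" and s = 1 and \<beta> = "y v" and t = "1 / ?N n"])
          (use subset_trans[OF FI IW] in simp_all)
    qed
  qed
  \<comment> \<open>Magnifying \<open>x\<close> around copy \<open>j\<close> recovers that copy and sends the other copies to infinity.\<close>
  have old: "\<forall>\<^sub>F n in sequentially. strict_facet ?W (\<lambda>w. lift (X n (Node D ch) w) (Y n w)) (shifted M D j ` e')"
    if D: "\<And>v. v \<in> words M L \<Longrightarrow> D v \<in> blocks d M" and ch: "ch j \<in> trees d M L"
      and j: "j < M" and e': "e' \<in> edges M L (ch j)" for D ch j e'
  proof -
    let ?T = "Node D ch"
    define g where "g = shifted M D j"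
    define I where "I = g ` words M L"
    define F where "F = g ` e'"
    have eW: "e' \<subseteq> words M L" using edges_props[OF ch e'] by simp
    have g: "copy D (g v) = j" "tl (g v) = v" if "v \<in> words M L" for v
      using copy[of D v j] D[OF that] j by (simp_all add: g_def tl)
    have inj: "inj_on g (words M L)" by (rule inj_on_inverseI[of _ tl]) (simp add: g)
    have IW: "I \<subseteq> ?W" using shifted_in_words[of _ M L j D d] j D by (auto simp: I_def g_def)
    have fin: "finite I" by (simp add: I_def)
    have FI: "F \<subseteq> I" using eW by (auto simp: F_def I_def)
    have base: "strict_facet I (\<lambda>w. lift (x (ch j) (tl w)) (y (tl w))) F"
      unfolding I_def F_def strict_facet_reindex[OF inj eW] using IH[OF ch e'] by (simp add: g_def tl)
    have copy_ne: "copy D w \<noteq> j \<and> copy D w < M" if w: "w \<in> ?W - I" for w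
    proof -
      have "(\<lambda>(j, v). shifted M D j v) ` ({..<M} \<times> words M L) = ?W"
        by (rule bij_betw_imp_surj_on[OF shifted_bij[of M L D d]]) (rule D)
      then have "w \<in> (\<lambda>(j, v). shifted M D j v) ` ({..<M} \<times> words M L)" using w by blast
      then obtain j' v' where w': "j' < M" "v' \<in> words M L" "w = shifted M D j' v'" by auto
      then have "j' \<noteq> j" using w by (auto simp: I_def g_def)
      then show ?thesis using w' copy[of D v' j'] D[OF w'(2)] by simp
    qed
    have "\<forall>\<^sub>F n in sequentially. strict_facet (I \<union> ?W)
        (\<lambda>w. lift (\<lambda>i. (X n ?T w i - pattern_x M j i) * ?N n) (Y n w)) F"
    proof (rule strict_facet_extend_lift[OF fin FI base,
          where \<alpha> = "\<lambda>w i. pattern_x M (copy D w) i - pattern_x M j i" and \<beta> = "\<lambda>_. 0"])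
      show "(\<lambda>n. (X n ?T w i - pattern_x M j i) * ?N n) \<longlonglongrightarrow> x (ch j) (tl w) i" if "w \<in> I" for w i
      proof -
        have "(X n ?T w i - pattern_x M j i) * ?N n = x (ch j) (tl w) i" for n
          using that g by (auto simp: I_def X_def)
        then show ?thesis by simp
      qed
      show "(\<lambda>n. Y n w / ?N n) \<longlonglongrightarrow> 0" for w by (rule small[OF Ylim])
      show "(\<lambda>n. (X n ?T w i - pattern_x M j i) * ?N n / ?N n)
          \<longlonglongrightarrow> pattern_x M (copy D w) i - pattern_x M j i" for w i
        using tendsto_diff[OF Xlim[of D ch w i] tendsto_const[of "pattern_x M j i"]] by simp
      show "pattern_x M (copy D w) 0 - pattern_x M j 0 \<noteq> 0 \<or> 0 \<noteq> (0::real)" if "w \<in> ?W - I" for w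
        using copy_ne[OF that] pattern_x_inj[of "copy D w" M j] j by simp
    qed (use Ylim in auto)
    then show ?thesis
      unfolding F_def[unfolded g_def, symmetric] Un_absorb1[OF IW]
    proof (rule eventually_mono)
      fix n assume "strict_facet ?W (\<lambda>w. lift (\<lambda>i. (X n ?T w i - pattern_x M j i) * ?N n) (Y n w)) F"
      then show "strict_facet ?W (\<lambda>w. lift (X n ?T w) (Y n w)) F"
        by (rule strict_facet_affine[where \<alpha> = "pattern_x M j" and s = "1 / ?N n" and \<beta> = 0 and t = 1])
          (use subset_trans[OF FI IW] in simp_all)
    qed
  qed
  have "\<forall>\<^sub>F n in sequentially. \<forall>T\<in>trees d M (Suc L). \<forall>F\<in>edges M (Suc L) T.
      strict_facet ?W (\<lambda>w. lift (X n T w) (Y n w)) F"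
  \<comment> \<open>Since there are finitely many trees and edges, a single scale n serves them all,
    as a common \<open>Y n\<close> demands.\<close>
  proof (intro eventually_ball_finite finite_trees ballI)
    fix T assume T: "T \<in> trees d M (Suc L)"
    show "finite (edges M (Suc L) T)"
      by (rule finite_subset[of _ "Pow ?W"]) (use edges_props[OF T] in auto)
    fix F assume F: "F \<in> edges M (Suc L) T"
    obtain D ch where T': "T = Node D ch" and D: "\<And>v. v \<in> words M L \<Longrightarrow> D v \<in> blocks d M"
      and ch: "\<And>j. j < M \<Longrightarrow> ch j \<in> trees d M L" using T by (auto simp: PiE_iff)
    show "\<forall>\<^sub>F n in sequentially. strict_facet ?W (\<lambda>w. lift (X n T w) (Y n w)) F"
      using F new[OF D] old[OF D ch] unfolding T' by auto
  qed
  moreover have "\<forall>\<^sub>F n in sequentially. \<forall>w\<in>?W. \<forall>w'\<in>?W. w \<noteq> w' \<longrightarrow> Y n w \<noteq> Y n w'"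
  proof (intro eventually_ball_finite finite_words ballI)
    fix w w' assume w: "w \<in> ?W" and w': "w' \<in> ?W"
    obtain m v m' v' where eq: "w = m # v" "m < M" "v \<in> words M L" "w' = m' # v'" "m' < M" "v' \<in> words M L"
      using w w' words_SucE by metis
    show "\<forall>\<^sub>F n in sequentially. w \<noteq> w' \<longrightarrow> Y n w \<noteq> Y n w'"
    proof (cases "v = v'")
      case True
      then show ?thesis using pattern_y_inj[of m M m'] eq by (auto simp: Y_def)
    next
      case False
      have "(\<lambda>n. Y n w - Y n w') \<longlonglongrightarrow> y v - y v'" using tendsto_diff[OF Ylim[of w] Ylim[of w']] eq by simp
      moreover have "y v - y v' \<noteq> 0" using False inj_y eq by (auto simp: inj_on_def)
      ultimately have "\<forall>\<^sub>F n in sequentially. Y n w - Y n w' \<noteq> 0" by (rule tendsto_imp_eventually_ne)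
      then show ?thesis by (rule eventually_mono) auto
    qed
  qed
  ultimately have "\<exists>n. (\<forall>T\<in>trees d M (Suc L). \<forall>F\<in>edges M (Suc L) T.
      strict_facet ?W (\<lambda>w. lift (X n T w) (Y n w)) F) \<and> (\<forall>w\<in>?W. \<forall>w'\<in>?W. w \<noteq> w' \<longrightarrow> Y n w \<noteq> Y n w')"
    by (intro eventually_happens'[OF sequentially_bot] eventually_conj)
  then obtain n where n: "\<forall>T\<in>trees d M (Suc L). \<forall>F\<in>edges M (Suc L) T.
      strict_facet ?W (\<lambda>w. lift (X n T w) (Y n w)) F" "\<forall>w\<in>?W. \<forall>w'\<in>?W. w \<noteq> w' \<longrightarrow> Y n w \<noteq> Y n w'"
    by (elim exE conjE)
  have "inj_on (Y n) ?W" using n(2) by (meson inj_onI)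
  with n(1) show ?case by (intro exI[of _ "X n"] exI[of _ "Y n"] conjI)
qed

section \<open>From strict facets to the polytope\<close>

lemma strict_facet_in_facet_hyperedges:
  assumes "finite I" "inj_on P I" "in_general_position (P ` I)" "card I \<ge> DIM('a) + 1"
    and F: "F \<subseteq> I" "card F = DIM('a)" and strict: "strict_facet I P F"
  shows "P ` F \<in> facet_hyperedges (convex hull (P ` I))"
proof -
  have V: "finite (P ` I)" "card (P ` I) \<ge> DIM('a) + 1" using assms by (auto simp: card_image)
  have C: "P ` F \<subseteq> P ` I" "card (P ` F) = DIM('a)"
    using F inj_on_subset[OF assms(2) F(1)] by (auto simp: card_image)
  \<comment> \<open>\<open>strict_facet\<close> speaks about all hyperplanes through
    \<open>F\<close>; that one exists follows since d points span at most dimension d - 1.\<close>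
  have "aff_dim (P ` F) < DIM('a)"
    using aff_dim_le_card[of "P ` F"] C V(1) by (simp add: finite_subset[OF C(1)])
  then obtain a b where ab: "a \<noteq> 0" "P ` F \<subseteq> {x. a \<bullet> x = b}" using aff_lowdim_subset_hyperplane by blast
  have "supports 0 I P F a b \<or> supports 0 I P F (- a) (- b)"
    using strict ab unfolding strict_facet_def by blast
  moreover have "P ` F \<in> facet_hyperedges (convex hull (P ` I))"
    if "\<And>v. v \<in> F \<Longrightarrow> a' \<bullet> P v = b'" "supports 0 I P F a' b'" for a' b'
  proof (rule supported_simplex_is_facet[OF assms(3) V C, of a' b'])
    show "a' \<bullet> p = b'" if "p \<in> P ` F" for p using that \<open>\<And>v. v \<in> F \<Longrightarrow> a' \<bullet> P v = b'\<close> by blast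
    show "a' \<bullet> p > b'" if "p \<in> P ` I - P ` F" for p
      using that \<open>supports 0 I P F a' b'\<close> by (auto simp: supports_def)
  qed
  ultimately show ?thesis
    using ab(2) by (metis (mono_tags, lifting) imageI inner_minus_left mem_Collect_eq subsetD)
qed

end

theorem theorem1p1:
  fixes d :: nat and r :: real
  assumes "d \<ge> 5" and "DIM('a::euclidean_space) = d" and "0 \<le> r" and "r < 1"
  shows "\<exists>P :: 'a set. simplicial_polytope P \<and> aff_dim P = int d \<and>
           transversal_ratio (poly_vertices P) (facet_hyperedges P) \<ge> r"
proof -
  obtain e :: "nat \<Rightarrow> 'a" where "bij_betw e {0..<card (Basis :: 'a set)} Basis"
    using ex_bij_betw_nat_finite[OF finite_Basis] by blast
  then interpret lifting d e
    using assms by unfold_locales (auto simp: atLeast0LessThan)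
  obtain M L T where size: "M > d" "L > 0" and T: "T \<in> trees d M L"
    and dense: "\<And>S. S \<subseteq> words M L \<Longrightarrow> real (card S) \<ge> (1 - r) * real (M ^ L) \<Longrightarrow> \<exists>e\<in>edges M L T. e \<subseteq> S"
    using dense_sets_contain_edges[of "1 - r" d] assms(4) by auto
  define W where "W = words M L"
  define E where "E = edges M L T"
  have E: "F \<subseteq> W \<and> card F = d" if "F \<in> E" for F using edges_props[OF T] that by (auto simp: W_def E_def)
  have finW: "finite W" by (simp add: W_def)
  have finE: "finite E" by (rule finite_subset[of _ "Pow W"]) (use E finW in auto)
  obtain P where P: "\<And>F. F \<in> E \<Longrightarrow> strict_facet W P F"
    using embedding[of M L] T unfolding W_def E_def by blast
  have "\<forall>F\<in>E. \<exists>\<delta>>0. \<forall>Q. (\<forall>v\<in>W. dist (Q v) (P v) < \<delta>) \<longrightarrow> strict_facet W Q F"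
    using strict_facet_perturb[OF finW] E P by blast
  then obtain \<delta> where \<delta>: "\<And>F. F \<in> E \<Longrightarrow> \<delta> F > 0"
    "\<And>F Q. F \<in> E \<Longrightarrow> \<forall>v\<in>W. dist (Q v) (P v) < \<delta> F \<Longrightarrow> strict_facet W Q F" by metis
  \<comment> \<open>The extra 1 keeps \<open>Min\<close> meaningful when there are no edges.\<close>
  define \<delta>0 where "\<delta>0 = Min (insert 1 (\<delta> ` E))"
  have \<delta>0: "\<delta>0 > 0" "\<And>F. F \<in> E \<Longrightarrow> \<delta>0 \<le> \<delta> F" using finE \<delta>(1) by (auto simp: \<delta>0_def)
  obtain Q where Q: "\<forall>v\<in>W. dist (Q v) (P v) < \<delta>0" "inj_on Q W" "in_general_position (Q ` W)"
    using general_position_perturbation[OF finW \<delta>0(1)] by blast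
  have strict: "strict_facet W Q F" if "F \<in> E" for F
    using Q(1) \<delta>0(2)[OF that] by (intro \<delta>(2)[OF that]) (meson less_le_trans)
  \<comment> \<open>Since \<open>L > 0\<close>, there are at least \<open>M > d\<close> points,
    enough for a full-dimensional hull.\<close>
  have "M ^ 1 \<le> M ^ L" using size by (intro power_increasing) auto
  then have cardW: "card W = M ^ L" "card W \<ge> d + 1" using size by (auto simp: W_def card_words)
  let ?V = "Q ` W"
  have V: "finite ?V" "card ?V = M ^ L" "card ?V \<ge> DIM('a) + 1"
    using finW Q(2) cardW assms(2) by (auto simp: card_image)
  have "1 - (1 - r) \<le> transversal_ratio (poly_vertices (convex hull ?V)) (facet_hyperedges (convex hull ?V))"
  proof (rule transversal_ratio_lower_bound)
    show "?V \<noteq> {}" using V(3) by auto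
    fix S assume S: "S \<subseteq> ?V" "real (card S) \<ge> (1 - r) * real (card ?V)"
    define S' where "S' = {w \<in> W. Q w \<in> S}"
    have "S = Q ` S'" using S(1) by (auto simp: S'_def)
    moreover have "inj_on Q S'" using inj_on_subset[OF Q(2)] by (auto simp: S'_def)
    ultimately have "card S = card S'" by (metis card_image)
    then obtain F where F: "F \<in> E" "F \<subseteq> S'"
      using dense[of S'] S(2) V(2) by (auto simp: S'_def W_def E_def)
    have "Q ` F \<in> facet_hyperedges (convex hull ?V)"
      using strict_facet_in_facet_hyperedges[OF finW Q(2,3)] E[OF F(1)] strict[OF F(1)] cardW assms(2) by simp
    moreover have "Q ` F \<subseteq> S" using F(2) by (auto simp: S'_def)
    ultimately show "\<exists>C\<in>facet_hyperedges (convex hull ?V). C \<subseteq> S" by blast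
  qed (use V assms in auto)
  then show ?thesis
    using simplicial_polytope_general_position[OF Q(3) V(1,3)]
      general_position_aff_dim[OF Q(3) V(1,3)] assms(2)
    by (intro exI[of _ "convex hull ?V"]) (auto simp: aff_dim_convex_hull)
qed

end
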